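(* Let $n\geq2$ be an integer, let $1\leq p<\infty$, and let $X=L^p(\mu)$ or $X=l^p$. Then $$\overline{C}_{mNJ}^{(n)}(X)=n^{\frac{2}{p}-1}\quad\text{if } 1\leq p\leq2 \text{ and } \dim X\geq n,$$ and $$\overline{C}_{mNJ}^{(n)}(X)=n^{-1}\Big(2^{1-n}\sum_{k=0}^{\lfloor n/2\rfloor}\binom{n}{k}(n-2k)^p\Big)^{\frac{2}{p}}\quad\text{if } 2<p<\infty\text{ and }\dim X\geq2^{n-1}.$$
   Context: $L^p(\mu)$ is the real Lebesgue space on a measure space $(\Omega,\Sigma,\mu)$. $l^p$ denotes the real sequence space with its usual $p$-norm, of finite or infinite dimension: either $l^p_k=(\mathbb{R}^k,\|\cdot\|_p)$ or the space of infinite $p$-summable sequences. $\lfloor\cdot\rfloor$ is the floor function. For a real Banach space $X$ with unit sphere $S(X)$, the upper modified $n$-th von Neumann-Jordan constant is $$\overline{C}_{mNJ}^{(n)}(X)=\sup\{C^{(n)}(x_1,\dots,x_n):x_1,\dots,x_n\in S(X)\},$$ where $$C^{(n)}(x_1,\dots,x_n)=\frac{\sum_{\theta_j=\pm1}\|x_1+\sum_{j=2}^n\theta_jx_j\|_X^2}{2^{n-1}\sum_{j=1}^n\|x_j\|_X^2},$$ the sum being over all $(\theta_2,\dots,\theta_n)\in\{-1,1\}^{n-1}$. *)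

theory Defs
  imports "HOL-Analysis.Analysis" "HOL-Algebra.Module" "HOL-Library.Extended_Nat"
begin

text \<open>
  Real normed spaces with an explicit carrier. Since the space depends on a measure, it cannot be a
  type of class \<open>real_normed_vector\<close>; we extend the module record of the algebra library instead.
  The fields \<open>mult\<close> and \<open>one\<close> that this record inherits from rings play no role.
\<close>

record 'v normed_module = "(real, 'v) module" +
  vnorm :: "'v \<Rightarrow> real"

definition unit_sphere :: "('v, 'm) normed_module_scheme \<Rightarrow> 'v set" where
  "unit_sphere X = {x \<in> carrier X. vnorm X x = 1}"

definition lin_indep :: "('v, 'm) normed_module_scheme \<Rightarrow> 'v set \<Rightarrow> bool" where
  "lin_indep X B \<longleftrightarrow> finite B \<and> B \<subseteq> carrier X \<and>
     (\<forall>a. (\<Oplus>\<^bsub>X\<^esub>v\<in>B. a v \<odot>\<^bsub>X\<^esub> v) = \<zero>\<^bsub>X\<^esub> \<longrightarrow> (\<forall>v\<in>B. a v = 0))"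

definition space_dim :: "('v, 'm) normed_module_scheme \<Rightarrow> enat" where
  "space_dim X = (SUP B\<in>{B. lin_indep X B}. enat (card B))"

definition mNJ_quotient :: "nat \<Rightarrow> ('v, 'm) normed_module_scheme \<Rightarrow> (nat \<Rightarrow> 'v) \<Rightarrow> real" where
  "mNJ_quotient n X x =
     (\<Sum>\<theta>\<in>{2..n} \<rightarrow>\<^sub>E {-1, 1}. (vnorm X (x 1 \<oplus>\<^bsub>X\<^esub> (\<Oplus>\<^bsub>X\<^esub>j\<in>{2..n}. \<theta> j \<odot>\<^bsub>X\<^esub> x j)))\<^sup>2) /
     (2 ^ (n - 1) * (\<Sum>j=1..n. (vnorm X (x j))\<^sup>2))"

text \<open>
  The supremum is taken in the reals: in a normed space the triangle inequality bounds the
  quotient by \<open>n\<close>.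
\<close>

definition upper_mNJ :: "nat \<Rightarrow> ('v, 'm) normed_module_scheme \<Rightarrow> real" where
  "upper_mNJ n X = (SUP x\<in>{1..n} \<rightarrow> unit_sphere X. mNJ_quotient n X x)"


subsection \<open>The spaces \<open>L\<^sup>p(\<mu>)\<close>\<close>

definition Lp_fun :: "real \<Rightarrow> 'a measure \<Rightarrow> ('a \<Rightarrow> real) set" where
  "Lp_fun p M = {f \<in> borel_measurable M. integrable M (\<lambda>t. \<bar>f t\<bar> powr p)}"

definition Lp_rel :: "real \<Rightarrow> 'a measure \<Rightarrow> (('a \<Rightarrow> real) \<times> ('a \<Rightarrow> real)) set" where
  "Lp_rel p M = {(f, g). f \<in> Lp_fun p M \<and> g \<in> Lp_fun p M \<and> (AE t in M. f t = g t)}"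

definition Lp_fun_norm :: "real \<Rightarrow> 'a measure \<Rightarrow> ('a \<Rightarrow> real) \<Rightarrow> real" where
  "Lp_fun_norm p M f = (\<integral>t. \<bar>f t\<bar> powr p \<partial>M) powr (1 / p)"

definition Lp :: "real \<Rightarrow> 'a measure \<Rightarrow> ('a \<Rightarrow> real) set normed_module" where
  "Lp p M = \<lparr>
     carrier = Lp_fun p M // Lp_rel p M,
     mult = undefined,
     one = undefined,
     zero = Lp_rel p M `` {\<lambda>t. 0},
     add = (\<lambda>F G. \<Union>f\<in>F. \<Union>g\<in>G. Lp_rel p M `` {\<lambda>t. f t + g t}),
     smult = (\<lambda>c F. \<Union>f\<in>F. Lp_rel p M `` {\<lambda>t. c * f t}),
     vnorm = (\<lambda>F. the_elem (Lp_fun_norm p M ` F))\<rparr>"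


subsection \<open>The spaces \<open>l\<^sup>p\<close>\<close>

text \<open>
  For \<open>d = enat k\<close> this is \<open>l\<^sup>p\<^sub>k\<close>, a vector of \<open>\<real>\<^sup>k\<close> being a sequence that vanishes from index \<open>k\<close>
  on (summability is then automatic); for \<open>d = \<infinity>\<close> it is the space of \<open>p\<close>-summable sequences.
\<close>

definition lp :: "real \<Rightarrow> enat \<Rightarrow> (nat \<Rightarrow> real) normed_module" where
  "lp p d = \<lparr>
     carrier = {x. (\<forall>i. d \<le> enat i \<longrightarrow> x i = 0) \<and> summable (\<lambda>i. \<bar>x i\<bar> powr p)},
     mult = undefined,
     one = undefined,
     zero = (\<lambda>i. 0),
     add = (\<lambda>x y i. x i + y i),
     smult = (\<lambda>c x i. c * x i),
     vnorm = (\<lambda>x. (\<Sum>i. \<bar>x i\<bar> powr p) powr (1 / p))\<rparr>"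


subsection \<open>The operations on classes are those on representatives\<close>

lemma powr_add_le: assumes "0 \<le> p" shows "\<bar>a + b :: real\<bar> powr p \<le> 2 powr p * (\<bar>a\<bar> powr p + \<bar>b\<bar> powr p)"
proof -
  have "\<bar>a + b\<bar> \<le> 2 * max \<bar>a\<bar> \<bar>b\<bar>" by linarith
  then have "\<bar>a + b\<bar> powr p \<le> (2 * max \<bar>a\<bar> \<bar>b\<bar>) powr p" using assms by (intro powr_mono2) auto
  also have "\<dots> = 2 powr p * (max \<bar>a\<bar> \<bar>b\<bar> powr p)" by (simp add: powr_mult)
  also have "\<dots> \<le> 2 powr p * (\<bar>a\<bar> powr p + \<bar>b\<bar> powr p)"
    by (intro mult_left_mono) (auto simp: max_def)
  finally show ?thesis .
qed

lemma Lp_fun_add: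
  assumes "0 \<le> p" "f \<in> Lp_fun p M" "g \<in> Lp_fun p M"
  shows "(\<lambda>t. f t + g t) \<in> Lp_fun p M"
proof -
  have [measurable]: "f \<in> borel_measurable M" "g \<in> borel_measurable M"
    using assms by (auto simp: Lp_fun_def)
  have "integrable M (\<lambda>t. 2 powr p * (\<bar>f t\<bar> powr p + \<bar>g t\<bar> powr p))"
    using assms by (auto simp: Lp_fun_def)
  then have "integrable M (\<lambda>t. \<bar>f t + g t\<bar> powr p)"
    by (rule Bochner_Integration.integrable_bound) (auto intro!: AE_I2 powr_add_le assms(1))
  then show ?thesis by (simp add: Lp_fun_def)
qed

lemma Lp_fun_scale:
  assumes "f \<in> Lp_fun p M" shows "(\<lambda>t. c * f t) \<in> Lp_fun p M"
  using assms by (auto simp: Lp_fun_def abs_mult powr_mult)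

lemma Lp_fun_zero: "(\<lambda>t. 0) \<in> Lp_fun p M" by (simp add: Lp_fun_def)

lemma equiv_Lp_rel: "equiv (Lp_fun p M) (Lp_rel p M)"
proof (rule equivI)
  show "trans (Lp_rel p M)" unfolding trans_def Lp_rel_def by auto
qed (auto simp: refl_on_def sym_def Lp_rel_def)

abbreviation Lp_class :: "real \<Rightarrow> 'a measure \<Rightarrow> ('a \<Rightarrow> real) \<Rightarrow> ('a \<Rightarrow> real) set" where
  "Lp_class p M f \<equiv> Lp_rel p M `` {f}"

lemma Lp_class_eq: "f \<in> Lp_fun p M \<Longrightarrow> g \<in> Lp_fun p M \<Longrightarrow> Lp_class p M f = Lp_class p M g \<longleftrightarrow> (AE t in M. f t = g t)"
  by (subst eq_equiv_class_iff[OF equiv_Lp_rel]) (auto simp: Lp_rel_def)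

lemma Lp_add:
  assumes "0 \<le> p" "f \<in> Lp_fun p M" "g \<in> Lp_fun p M"
  shows "Lp_class p M f \<oplus>\<^bsub>Lp p M\<^esub> Lp_class p M g = Lp_class p M (\<lambda>t. f t + g t)"
proof -
  have "(\<lambda>f g. Lp_class p M (\<lambda>t. f t + g t)) respects2 (Lp_rel p M)"
    unfolding congruent2_def
    by (auto simp: Lp_rel_def[of p M] intro!: equiv_class_eq[OF equiv_Lp_rel] Lp_fun_add assms(1))
  from UN_equiv_class2[OF equiv_Lp_rel equiv_Lp_rel this assms(2,3)]
  show ?thesis by (simp add: Lp_def)
qed

lemma Lp_smult:
  assumes "f \<in> Lp_fun p M"
  shows "c \<odot>\<^bsub>Lp p M\<^esub> Lp_class p M f = Lp_class p M (\<lambda>t. c * f t)"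
proof -
  have "(\<lambda>f. Lp_class p M (\<lambda>t. c * f t)) respects (Lp_rel p M)"
    unfolding congruent_def
    by (auto simp: Lp_rel_def[of p M] intro!: equiv_class_eq[OF equiv_Lp_rel] Lp_fun_scale)
  from UN_equiv_class[OF equiv_Lp_rel this assms]
  show ?thesis by (simp add: Lp_def)
qed

lemma Lp_vnorm:
  assumes "f \<in> Lp_fun p M"
  shows "vnorm (Lp p M) (Lp_class p M f) = Lp_fun_norm p M f"
proof -
  have "Lp_fun_norm p M g = Lp_fun_norm p M f" if "g \<in> Lp_class p M f" for g
  proof -
    have "(\<integral>t. \<bar>g t\<bar> powr p \<partial>M) = (\<integral>t. \<bar>f t\<bar> powr p \<partial>M)"
      using that by (intro integral_cong_AE) (auto simp: Lp_rel_def Lp_fun_def)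
    then show ?thesis by (simp add: Lp_fun_norm_def)
  qed
  moreover have "f \<in> Lp_class p M f" using assms by (auto simp: Lp_rel_def)
  ultimately have "Lp_fun_norm p M ` Lp_class p M f = {Lp_fun_norm p M f}" by blast
  then show ?thesis by (simp add: Lp_def)
qed

lemma Lp_carrierE:
  assumes "F \<in> carrier (Lp p M)" obtains f where "f \<in> Lp_fun p M" "F = Lp_class p M f"
  using assms by (auto simp: Lp_def elim: quotientE)

lemma Lp_class_carrier: "f \<in> Lp_fun p M \<Longrightarrow> Lp_class p M f \<in> carrier (Lp p M)"
  by (auto simp: Lp_def quotientI)

lemma Lp_abelian_group: assumes "0 \<le> p" shows "abelian_group (Lp p M)"
proof (rule abelian_groupI)
  note [simp] = Lp_add[OF assms] Lp_fun_add[OF assms] Lp_fun_scale Lp_class_carrier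
  have z: "\<zero>\<^bsub>Lp p M\<^esub> = Lp_class p M (\<lambda>t. 0)" by (simp add: Lp_def)
  show "\<zero>\<^bsub>Lp p M\<^esub> \<in> carrier (Lp p M)" by (simp add: z Lp_fun_zero)
  fix x assume "x \<in> carrier (Lp p M)"
  then obtain f where f: "f \<in> Lp_fun p M" "x = Lp_class p M f" by (rule Lp_carrierE)
  show "\<zero>\<^bsub>Lp p M\<^esub> \<oplus>\<^bsub>Lp p M\<^esub> x = x" using f by (simp add: z Lp_fun_zero)
  have "(\<lambda>t. - f t) \<in> Lp_fun p M" using Lp_fun_scale[OF f(1), of "-1"] by simp
  then show "\<exists>y\<in>carrier (Lp p M). y \<oplus>\<^bsub>Lp p M\<^esub> x = \<zero>\<^bsub>Lp p M\<^esub>"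
    using f by (intro bexI[of _ "Lp_class p M (\<lambda>t. - f t)"]) (auto simp: z)
next
  fix x y assume "x \<in> carrier (Lp p M)" "y \<in> carrier (Lp p M)"
  then show "x \<oplus>\<^bsub>Lp p M\<^esub> y \<in> carrier (Lp p M)" "x \<oplus>\<^bsub>Lp p M\<^esub> y = y \<oplus>\<^bsub>Lp p M\<^esub> x"
    by (auto elim!: Lp_carrierE simp: Lp_add assms add.commute intro!: Lp_class_carrier Lp_fun_add)
next
  fix x y z assume "x \<in> carrier (Lp p M)" "y \<in> carrier (Lp p M)" "z \<in> carrier (Lp p M)"
  then show "x \<oplus>\<^bsub>Lp p M\<^esub> y \<oplus>\<^bsub>Lp p M\<^esub> z = x \<oplus>\<^bsub>Lp p M\<^esub> (y \<oplus>\<^bsub>Lp p M\<^esub> z)"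
    by (auto elim!: Lp_carrierE simp: Lp_add assms Lp_fun_add add.assoc)
qed

lemma lp_abelian_group: assumes "0 \<le> p" shows "abelian_group (lp p d)"
proof -
  have s: "summable (\<lambda>i. \<bar>x i + y i\<bar> powr p)" if "summable (\<lambda>i. \<bar>x i\<bar> powr p)" "summable (\<lambda>i. \<bar>y i\<bar> powr p)" for x y :: "nat \<Rightarrow> real"
    by (rule summable_comparison_test'[OF summable_mult[OF summable_add[OF that]], of 0 _ "2 powr p"]) (auto intro: powr_add_le assms)
  show ?thesis
  proof (rule abelian_groupI)
    fix x assume "x \<in> carrier (lp p d)"
    then show "\<exists>y\<in>carrier (lp p d). y \<oplus>\<^bsub>lp p d\<^esub> x = \<zero>\<^bsub>lp p d\<^esub>"
      by (intro bexI[of _ "\<lambda>i. - x i"]) (auto simp: lp_def)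
  qed (auto simp: lp_def s algebra_simps)
qed

end

theory Submission imports Defs begin

text \<open>
  Both formulas come from one estimate each for \<open>\<Sum>\<^sub>\<theta> \<parallel>x\<^sub>1 + \<Sum>\<theta>\<^sub>j x\<^sub>j\<parallel>\<^sup>2\<close> over unit vectors, and from an explicit
  family for which every one of the \<open>2\<^sup>n\<^sup>-\<^sup>1\<close> norms takes the same, extremal value.

  For \<open>p \<le> 2\<close>, Minkowski's inequality moves the quadratic mean over the signs inside the
  \<open>L\<^sup>p\<close> norm (\<open>sum_Lp_fun_norm_power2_le\<close>). There the signs are orthogonal, which leaves the square
  function \<open>(\<Sum>x\<^sub>j\<^sup>2)\<^sup>1\<^sup>/\<^sup>2\<close>, and its \<open>p\<close>-th power is at most \<open>\<Sum>\<bar>x\<^sub>j\<bar>\<^sup>p\<close>. Equality holds for \<open>n\<close> functions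
  with disjoint supports.

  For \<open>p > 2\<close>, Jensen's inequality replaces the quadratic mean over the signs by the mean of order
  \<open>p\<close>, and exchanging sum and integral reduces the question to real numbers: among all \<open>a\<close> with prescribed
  \<open>\<Sum>\<bar>a\<^sub>j\<bar>\<^sup>p\<close>, the sum \<open>\<Sum>\<^sub>\<theta> \<bar>\<Sum>\<theta>\<^sub>j a\<^sub>j\<bar>\<^sup>p\<close> is largest when all \<open>\<bar>a\<^sub>j\<bar>\<close> agree (\<open>sign_sum_powr_le\<close>). This is
  shown by moving two of the numbers \<open>b\<^sub>j = \<bar>a\<^sub>j\<bar>\<^sup>p\<close> towards each other. Already the four terms
  \<open>\<bar>s \<plusminus> b\<^sub>1\<^sup>1\<^sup>/\<^sup>p \<plusminus> b\<^sub>2\<^sup>1\<^sup>/\<^sup>p\<bar>\<^sup>p\<close> with a fixed contribution \<open>s\<close> of the other coordinates then do not decrease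
  in sum (\<open>pair_smoothing\<close>). The sign of the derivative is an inequality between products of sums of two
  powers, which splits into instances of the convexity of \<open>t \<mapsto> t\<^sup>r\<close>, \<open>r = p - 1 \<ge> 1\<close>
  (\<open>signed_powr_ratio_le\<close>). Equality holds for the \<open>n\<close> Rademacher-like functions that realise all
  \<open>2\<^sup>n\<^sup>-\<^sup>1\<close> sign patterns on as many disjoint sets.

  The extremal families need disjoint sets of finite positive measure. A space of dimension at least
  \<open>m\<close> provides \<open>m\<close> of them (\<open>exists_disjoint_positive_sets\<close>): if at most \<open>k < m\<close> such sets existed, a maximal
  system would consist of atoms, and a nontrivial combination of \<open>m\<close> independent functions with mean zero on each of these
  atoms, which exists by counting equations, would vanish almost everywhere.

  The spaces \<open>L\<^sup>p(\<mu>)\<close> and \<open>l\<^sup>p\<close> are treated together, the latter being \<open>L\<^sup>p\<close> of a counting measure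
  (locale \<open>Lp_realization\<close>).
\<close>


section \<open>Power inequalities\<close>

text \<open>
  The second derivative gives convexity only on the open half-line; the origin is handled separately
  because \<open>0\<close> is a possible value of every coordinate below.
\<close>

lemma convex_on_powr:
  assumes "1 \<le> r"
  shows "convex_on {0..} (\<lambda>x::real. x powr r)"
proof -
  have origin: "(v * y) powr r \<le> v * y powr r" if "0 \<le> v" "v \<le> 1" for v y :: real
    using mult_right_mono[of "v powr r" "v" "y powr r"] powr_mono'[of 1 r v] that assms
    by (simp add: powr_mult)
  show ?thesis
  proof (rule convex_onI)
    fix t x y :: real
    assume t: "0 < t" "t < 1" and xy: "x \<in> {0..}" "y \<in> {0..}"
    consider "x = 0" | "y = 0" | "0 < x" "0 < y" using xy by fastforce
    then show "((1 - t) *\<^sub>R x + t *\<^sub>R y) powr r \<le> (1 - t) * x powr r + t * y powr r"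
    proof cases
      case 3
      then show ?thesis using convex_onD[OF powr_convex[OF assms], of t x y] t by simp
    qed (use origin[of t y] origin[of "1 - t" x] t in simp_all)
  qed simp
qed

text \<open>
  Of two pairs with the same sum, the one that is further apart has the larger sum of convex values.
  All product inequalities of the next section rest on instances of this one.
\<close>

lemma powr_add_le_of_spread:
  fixes a b c d r :: real
  assumes "1 \<le> r" "0 \<le> d" "d \<le> b" "b \<le> a" "a + d = b + c"
  shows "b powr r + c powr r \<le> a powr r + d powr r"
proof (cases "a = d")
  case True
  then show ?thesis using assms by simp
next
  case False
  then have ad: "d < a" using assms by simp
  define l where "l = (b - d) / (a - d)"
  have l: "0 \<le> l" "l \<le> 1" using ad assms by (auto simp: l_def)
  have "l * (a - d) = b - d" using ad by (simp add: l_def)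
  then have b: "b = (1 - l) * d + l * a" and c: "c = (1 - l) * a + l * d"
    using assms(5) by (auto simp: algebra_simps)
  have cv: "convex_on {0..} (\<lambda>x::real. x powr r)" by (rule convex_on_powr) fact
  have "b powr r \<le> (1 - l) * d powr r + l * a powr r"
    using convex_onD[OF cv l, of d a] assms by (simp add: b)
  moreover have "c powr r \<le> (1 - l) * a powr r + l * d powr r"
    using convex_onD[OF cv l, of a d] assms by (simp add: c)
  ultimately show ?thesis by (simp add: algebra_simps)
qed

lemma powr_superadditive:
  fixes x y r :: real
  assumes "1 \<le> r" "0 \<le> x" "0 \<le> y"
  shows "x powr r + y powr r \<le> (x + y) powr r"
  using powr_add_le_of_spread[of r 0 x "x + y" y] assms by simp

lemma sum_powr_subadditive:
  fixes y :: "'i \<Rightarrow> real"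
  assumes q: "0 < q" "q \<le> 1" and I: "finite I" and y: "\<And>j. j \<in> I \<Longrightarrow> 0 \<le> y j"
  shows "(\<Sum>j\<in>I. y j) powr q \<le> (\<Sum>j\<in>I. y j powr q)"
  using I y
proof (induction I)
  case (insert i I)
  let ?s = "\<Sum>j\<in>I. y j"
  have s: "0 \<le> ?s" "0 \<le> y i" using insert.prems by (auto intro: sum_nonneg)
  have "(y i powr q) powr (1 / q) + (?s powr q) powr (1 / q) \<le> (y i powr q + ?s powr q) powr (1 / q)"
    using q by (intro powr_superadditive) auto
  then have "y i + ?s \<le> (y i powr q + ?s powr q) powr (1 / q)"
    using q s by (simp add: powr_powr)
  then have "(y i + ?s) powr q \<le> ((y i powr q + ?s powr q) powr (1 / q)) powr q"
    using q s by (intro powr_mono2) auto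
  also have "\<dots> = y i powr q + ?s powr q" using q by (simp add: powr_powr)
  finally show ?case using insert by simp
qed simp

lemma power2_powr_half: "(x\<^sup>2) powr (p / 2) = \<bar>x\<bar> powr p" for x p :: real
proof -
  have "x\<^sup>2 = \<bar>x\<bar> powr 2" by simp
  then show ?thesis by (simp only: powr_powr) simp
qed

text \<open>
  Hoelder's inequality with exponents \<open>1 / (1 - q)\<close> and \<open>1 / q\<close>: after normalising both sums to \<open>1\<close>, it is
  the weighted inequality of arithmetic and geometric means in each term.
\<close>

lemma sum_powr_mult_powr_le:
  fixes w y :: "'i \<Rightarrow> real"
  assumes T: "finite T" and w: "\<And>\<theta>. \<theta> \<in> T \<Longrightarrow> 0 \<le> w \<theta>" and y: "\<And>\<theta>. \<theta> \<in> T \<Longrightarrow> 0 \<le> y \<theta>"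
    and q: "0 < q" "q \<le> 1"
  shows "(\<Sum>\<theta>\<in>T. w \<theta> powr (1 - q) * y \<theta> powr q) \<le> (\<Sum>\<theta>\<in>T. w \<theta>) powr (1 - q) * (\<Sum>\<theta>\<in>T. y \<theta>) powr q"
proof (cases "(\<Sum>\<theta>\<in>T. w \<theta>) = 0 \<or> (\<Sum>\<theta>\<in>T. y \<theta>) = 0")
  case True
  then have "\<forall>\<theta>\<in>T. w \<theta> powr (1 - q) * y \<theta> powr q = 0"
    using sum_nonneg_eq_0_iff[OF T, of w] sum_nonneg_eq_0_iff[OF T, of y] w y by auto
  then have "(\<Sum>\<theta>\<in>T. w \<theta> powr (1 - q) * y \<theta> powr q) = 0"
    by (intro sum.neutral)
  then show ?thesis by simp
next
  case False
  define W where "W = (\<Sum>\<theta>\<in>T. w \<theta>)"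
  define Y where "Y = (\<Sum>\<theta>\<in>T. y \<theta>)"
  have WY: "0 < W" "0 < Y" using False w y by (auto simp: W_def Y_def less_le sum_nonneg)
  have "(\<Sum>\<theta>\<in>T. (w \<theta> / W) powr (1 - q) * (y \<theta> / Y) powr q) \<le> (\<Sum>\<theta>\<in>T. (1 - q) * (w \<theta> / W) + q * (y \<theta> / Y))"
  proof (rule sum_mono)
    fix \<theta> assume \<theta>: "\<theta> \<in> T"
    show "(w \<theta> / W) powr (1 - q) * (y \<theta> / Y) powr q \<le> (1 - q) * (w \<theta> / W) + q * (y \<theta> / Y)"
    proof (cases "w \<theta> = 0 \<or> y \<theta> = 0")
      case True
      then show ?thesis using w[OF \<theta>] y[OF \<theta>] q WY by auto
    next
      case False
      then show ?thesis using w[OF \<theta>] y[OF \<theta>] q WY by (intro Youngs_inequality_0) auto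
    qed
  qed
  also have "\<dots> = (1 - q) * (W / W) + q * (Y / Y)"
    by (simp add: sum.distrib W_def Y_def flip: sum_distrib_left sum_divide_distrib)
  also have "\<dots> = 1" using WY by simp
  finally have "(\<Sum>\<theta>\<in>T. (w \<theta> / W) powr (1 - q) * (y \<theta> / Y) powr q) \<le> 1" .
  moreover have "(\<Sum>\<theta>\<in>T. (w \<theta> / W) powr (1 - q) * (y \<theta> / Y) powr q)
      = (\<Sum>\<theta>\<in>T. w \<theta> powr (1 - q) * y \<theta> powr q) / (W powr (1 - q) * Y powr q)"
    unfolding sum_divide_distrib using w y WY by (intro sum.cong refl) (simp add: powr_divide)
  ultimately show ?thesis using WY by (simp add: W_def Y_def divide_le_eq)
qed

text \<open>
  Jensen's inequality for \<open>t \<mapsto> t\<^sup>p\<^sup>/\<^sup>2\<close> and the uniform distribution on \<open>T\<close>.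
\<close>

lemma sum_power2_le_of_sum_powr:
  fixes y :: "'i \<Rightarrow> real"
  assumes p: "2 \<le> p" and T: "finite T" "T \<noteq> {}" and y: "\<And>\<theta>. \<theta> \<in> T \<Longrightarrow> 0 \<le> y \<theta>"
  shows "(\<Sum>\<theta>\<in>T. (y \<theta>)\<^sup>2) \<le> real (card T) * ((\<Sum>\<theta>\<in>T. y \<theta> powr p) / real (card T)) powr (2 / p)"
proof -
  have c: "0 < real (card T)" using T by (simp add: card_gt_0_iff)
  have "(\<Sum>\<theta>\<in>T. (1 / real (card T)) *\<^sub>R (y \<theta>)\<^sup>2) powr (p / 2)
      \<le> (\<Sum>\<theta>\<in>T. (1 / real (card T)) * ((y \<theta>)\<^sup>2) powr (p / 2))"
    using p T by (intro convex_on_sum[OF T convex_on_powr]) auto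
  also have "\<dots> = (\<Sum>\<theta>\<in>T. y \<theta> powr p) / real (card T)"
    using y by (simp add: sum_divide_distrib power2_powr_half)
  finally have "((\<Sum>\<theta>\<in>T. (y \<theta>)\<^sup>2) / real (card T)) powr (p / 2) \<le> (\<Sum>\<theta>\<in>T. y \<theta> powr p) / real (card T)"
    by (simp add: sum_divide_distrib)
  then have "(((\<Sum>\<theta>\<in>T. (y \<theta>)\<^sup>2) / real (card T)) powr (p / 2)) powr (2 / p)
      \<le> ((\<Sum>\<theta>\<in>T. y \<theta> powr p) / real (card T)) powr (2 / p)"
    using p by (intro powr_mono2) auto
  then have "(\<Sum>\<theta>\<in>T. (y \<theta>)\<^sup>2) / real (card T) \<le> ((\<Sum>\<theta>\<in>T. y \<theta> powr p) / real (card T)) powr (2 / p)"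
    using p c by (simp add: powr_powr sum_nonneg)
  then show ?thesis using c by (simp add: divide_le_eq mult.commute)
qed


section \<open>Equalising two coordinates\<close>

text \<open>
  The odd extension of \<open>t \<mapsto> t\<^sup>r\<close>; for \<open>r = p - 1\<close> it is, up to the factor \<open>p\<close>, the derivative of \<open>\<bar>t\<bar>\<^sup>p\<close>.
\<close>

definition signed_powr :: "real \<Rightarrow> real \<Rightarrow> real" where
  "signed_powr r x = sgn x * \<bar>x\<bar> powr r"

lemma signed_powr_nonneg: "0 \<le> x \<Longrightarrow> signed_powr r x = x powr r"
  by (cases "x = 0") (auto simp: signed_powr_def)

lemma signed_powr_minus: "signed_powr r (- x) = - signed_powr r x"
  by (auto simp: signed_powr_def sgn_if)

text \<open>
  Both sides are compared with the first factor on the right times \<open>(2 y)\<^sup>r\<close>. Multiplying out the left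
  side gives four powers whose bases add up in pairs to \<open>2 y (x + z)\<close> and \<open>2 y (x - z)\<close>, so it is at most
  that product by superadditivity; and \<open>(2 y)\<^sup>r \<le> (x + y)\<^sup>r - (x - y)\<^sup>r\<close> by superadditivity again.
\<close>

lemma powr_sum_product_le:
  fixes x y z r :: real
  assumes r: "1 \<le> r" and o: "0 \<le> z" "z \<le> y" "y \<le> x"
  shows "((y + z) powr r + (y - z) powr r) * ((x + y) powr r + (x - y) powr r)
       \<le> ((x + z) powr r + (x - z) powr r) * ((x + y) powr r - (x - y) powr r)"
proof -
  have sup: "(p * q) powr r + (s * t) powr r \<le> (p * q + s * t) powr r"
    if "0 \<le> p" "0 \<le> q" "0 \<le> s" "0 \<le> t" for p q s t
    using powr_superadditive[OF r, of "p * q" "s * t"] that by simp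
  have 1: "((y + z) * (x + y)) powr r + ((y - z) * (x - y)) powr r \<le> (2 * y * (x + z)) powr r"
    using sup[of "y + z" "x + y" "y - z" "x - y"] o by (simp add: algebra_simps)
  have 2: "((y + z) * (x - y)) powr r + ((y - z) * (x + y)) powr r \<le> (2 * y * (x - z)) powr r"
    using sup[of "y + z" "x - y" "y - z" "x + y"] o by (simp add: algebra_simps)
  have 3: "(2 * y) powr r \<le> (x + y) powr r - (x - y) powr r"
    using powr_superadditive[OF r, of "2 * y" "x - y"] o by (simp add: add.commute)
  have "((y + z) powr r + (y - z) powr r) * ((x + y) powr r + (x - y) powr r)
      = ((y + z) * (x + y)) powr r + ((y - z) * (x - y)) powr r
        + (((y + z) * (x - y)) powr r + ((y - z) * (x + y)) powr r)"
    unfolding powr_mult by (simp add: algebra_simps)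
  also have "\<dots> \<le> (2 * y * (x + z)) powr r + (2 * y * (x - z)) powr r" using 1 2 by simp
  also have "\<dots> = ((x + z) powr r + (x - z) powr r) * (2 * y) powr r"
    unfolding powr_mult by (simp add: algebra_simps)
  also have "\<dots> \<le> ((x + z) powr r + (x - z) powr r) * ((x + y) powr r - (x - y) powr r)"
    using 3 by (intro mult_left_mono) auto
  finally show ?thesis .
qed

text \<open>
  Moving the negative terms to the other side leaves four powers on each side. Their bases can be grouped
  into pairs with equal sums such that the pair on the right is the more spread one.
\<close>

lemma powr_diff_product_le:
  fixes x y z r :: real
  assumes r: "1 \<le> r" and o: "0 \<le> z" "z \<le> y" "y \<le> x"
  shows "((x + z) powr r - (x - z) powr r) * ((y + z) powr r + (y - z) powr r)
       \<le> ((x + y) powr r - (x - y) powr r) * ((y + z) powr r - (y - z) powr r)"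
proof -
  \<comment> \<open>products of nonnegative differences, which order the eight bases\<close>
  have "z * z \<le> x * z" "y * z \<le> x * z" "0 \<le> y * y" "0 \<le> y * z" "y * z \<le> x * y" "y * z \<le> y * y" "z * z \<le> y * z"
    using o by (auto intro!: mult_mono mult_right_mono simp: mult.commute)
  moreover have "0 \<le> (x - z) * (y - z)" "0 \<le> (x - y) * (y - z)" "0 \<le> (x - y) * (y + z)" "0 \<le> (y - z) * (y - z)"
    using o by auto
  ultimately have
    1: "((x + z) * (y + z)) powr r + ((x + y) * (y - z)) powr r
        \<le> ((x + y) * (y + z)) powr r + ((x - z) * (y - z)) powr r" and
    2: "((x + z) * (y - z)) powr r + ((x - y) * (y + z)) powr r
        \<le> ((x - z) * (y + z)) powr r + ((x - y) * (y - z)) powr r"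
    by (intro powr_add_le_of_spread r; simp add: algebra_simps)+
  show ?thesis using 1 2 unfolding powr_mult by (simp add: algebra_simps)
qed

text \<open>
  This is the sign of a derivative in disguise. With \<open>h(t) = signed_powr r (t + s) + signed_powr r (t - s)\<close> it
  says that \<open>h(v) / h(u)\<close> is at most \<open>((u + v)\<^sup>r - (u - v)\<^sup>r) / ((u + v)\<^sup>r + (u - v)\<^sup>r)\<close>. The quotient \<open>h(t) / t\<close>
  need not be monotone when \<open>r < 2\<close>, so the proof follows the position of \<open>s\<close> relative to \<open>v\<close> and \<open>u\<close>:
  outside \<open>[v, u]\<close> it is one of the two product inequalities above, inside it the factors can be compared
  one by one.
\<close>

lemma signed_powr_ratio_le:
  fixes s u v r :: real
  assumes r: "1 \<le> r" and v: "0 \<le> v" "v \<le> u" and s: "0 \<le> s"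
  shows "(signed_powr r (v + s) + signed_powr r (v - s)) * ((u + v) powr r + (u - v) powr r)
       \<le> (signed_powr r (u + s) + signed_powr r (u - s)) * ((u + v) powr r - (u - v) powr r)"
proof -
  consider "s \<le> v" | "v \<le> s" "s \<le> u" | "u \<le> s" by linarith
  then show ?thesis
  proof cases
    case 1
    then show ?thesis using powr_sum_product_le[OF r s 1 v(2)] assms by (simp add: signed_powr_nonneg)
  next
    case 2
    have V: "signed_powr r (v + s) + signed_powr r (v - s) = (s + v) powr r - (s - v) powr r"
      using 2 assms signed_powr_minus[of r "s - v"] by (simp add: signed_powr_nonneg add.commute)
    have U: "signed_powr r (u + s) + signed_powr r (u - s) = (u + s) powr r + (u - s) powr r"
      using 2 assms by (simp add: signed_powr_nonneg)
    have "(u - v) powr r + (s + v) powr r \<le> (u + v) powr r + (s - v) powr r"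
      using powr_add_le_of_spread[OF r, of "s - v" "u - v" "u + v" "s + v"] 2 assms by simp
    then have "(s + v) powr r - (s - v) powr r \<le> (u + v) powr r - (u - v) powr r" by simp
    moreover have "(u + v) powr r + (u - v) powr r \<le> (u + s) powr r + (u - s) powr r"
      using powr_add_le_of_spread[OF r, of "u - s" "u + v" "u + s" "u - v"] 2 assms by simp
    moreover have "(s - v) powr r \<le> (s + v) powr r" using 2 assms by (intro powr_mono2) auto
    ultimately show ?thesis unfolding U V
      by (subst mult.commute) (intro mult_mono; simp)
  next
    case 3
    have h: "signed_powr r (w + s) + signed_powr r (w - s) = (s + w) powr r - (s - w) powr r"
      if "0 \<le> w" "w \<le> s" for w
      using that signed_powr_minus[of r "s - w"] by (simp add: signed_powr_nonneg add.commute)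
    show ?thesis using powr_diff_product_le[OF r v 3] 3 v s by (simp add: h)
  qed
qed

lemma has_field_derivative_abs_powr:
  fixes x p :: real
  assumes "1 < p"
  shows "((\<lambda>x. \<bar>x\<bar> powr p) has_field_derivative p * signed_powr (p - 1) x) (at x)"
proof -
  consider "x > 0" | "x < 0" | "x = 0" by linarith
  then show ?thesis
  proof cases
    case 1
    have "((\<lambda>x. x powr p) has_field_derivative p * x powr (p - 1)) (at x)"
      using 1 by (auto intro!: derivative_eq_intros simp: powr_diff)
    moreover have "\<forall>\<^sub>F y in nhds x. y powr p = \<bar>y\<bar> powr p"
      using eventually_nhds_in_open[of "{0<..}" x] 1 by (auto elim!: eventually_mono)
    ultimately show ?thesis
      using 1 by (subst (asm) DERIV_cong_ev[OF refl _ refl]) (auto simp: signed_powr_def)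
  next
    case 2
    have "((\<lambda>x. (- x) powr p) has_field_derivative - (p * (- x) powr (p - 1))) (at x)"
      using 2 by (auto intro!: derivative_eq_intros simp: powr_diff)
    moreover have "\<forall>\<^sub>F y in nhds x. (- y) powr p = \<bar>y\<bar> powr p"
      using eventually_nhds_in_open[of "{..<0}" x] 2 by (auto elim!: eventually_mono)
    ultimately show ?thesis
      using 2 by (subst (asm) DERIV_cong_ev[OF refl _ refl]) (auto simp: signed_powr_def)
  next
    case 3
    have "((\<lambda>h::real. \<bar>h\<bar> powr (p - 1)) \<longlongrightarrow> 0) (at 0)"
      using assms by (auto intro!: tendsto_eq_intros)
    then have "((\<lambda>h::real. (\<bar>h\<bar> powr p) / h) \<longlongrightarrow> 0) (at 0)"
    proof (rule Lim_null_comparison[rotated], intro always_eventually allI)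
      fix h :: real show "norm (\<bar>h\<bar> powr p / h) \<le> \<bar>h\<bar> powr (p - 1)"
        by (cases "h = 0") (auto simp: powr_diff)
    qed
    then show ?thesis using assms 3 by (simp add: DERIV_def signed_powr_def)
  qed
qed

text \<open>
  \<open>signed_powr_ratio_le\<close> for \<open>u = b + a\<close> and \<open>v = b - a\<close>, in which \<open>u + v = 2 b\<close> and \<open>u - v = 2 a\<close>. In the
  application \<open>a\<^sup>p\<close> and \<open>b\<^sup>p\<close> are the two coordinates, and \<open>a\<^sup>-\<^sup>r / p\<close> and \<open>b\<^sup>-\<^sup>r / p\<close> are the speeds at
  which \<open>a\<close> and \<open>b\<close> move when the coordinates move at unit speed.
\<close>

lemma pair_smoothing_derivative_sign:
  fixes a b s r :: real
  assumes r: "1 \<le> r" and ab: "0 < a" "a \<le> b"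
  shows "(signed_powr r (s + b + a) + signed_powr r (s + b - a) - signed_powr r (s - b + a) - signed_powr r (s - b - a)) * b powr (- r)
       \<le> (signed_powr r (s + b + a) - signed_powr r (s + b - a) + signed_powr r (s - b + a) - signed_powr r (s - b - a)) * a powr (- r)"
proof -
  define P where "P = signed_powr r (s + b + a) - signed_powr r (s - b - a)"
  define Q where "Q = signed_powr r (s + b - a) - signed_powr r (s - b + a)"
  have neg: "signed_powr r (s - b - a) = - signed_powr r (b + a - s)" "signed_powr r (s - b + a) = - signed_powr r (b - a - s)"
    using signed_powr_minus[of r "b + a - s"] signed_powr_minus[of r "b - a - s"] by (simp_all add: algebra_simps)
  have "Q * ((2 * b) powr r + (2 * a) powr r) \<le> P * ((2 * b) powr r - (2 * a) powr r)"
  proof (cases "0 \<le> s")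
    case True
    show ?thesis
      using signed_powr_ratio_le[OF r _ _ True, of "b - a" "b + a"] ab unfolding P_def Q_def neg
      by (simp add: algebra_simps)
  next
    case False
    then have "0 \<le> - s" by simp
    then show ?thesis
      using signed_powr_ratio_le[OF r, of "b - a" "b + a" "- s"] ab unfolding P_def Q_def neg
      by (simp add: algebra_simps)
  qed
  then have "2 powr r * ((P + Q) * a powr r) \<le> 2 powr r * ((P - Q) * b powr r)"
    unfolding powr_mult by (simp add: algebra_simps)
  then have "(P + Q) * a powr r \<le> (P - Q) * b powr r" by simp
  then have "(P + Q) * b powr (- r) \<le> (P - Q) * a powr (- r)"
    using ab by (simp add: powr_minus field_simps)
  then show ?thesis by (simp add: P_def Q_def algebra_simps)
qed

text \<open>
  The two coordinates are \<open>c + x\<close> and \<open>c - x\<close>. Their sum is fixed, and the four terms are those for the four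
  choices of sign, so the claim is that bringing the coordinates closer together does not decrease the sum.
  The derivative exists only for \<open>x < c\<close>, hence the appeal to continuity at the ends.
\<close>

lemma pair_smoothing:
  fixes c s t t' p :: real
  assumes p: "2 \<le> p" and t: "0 \<le> t'" "t' \<le> t" "t \<le> c"
  defines "F \<equiv> (\<lambda>x. \<bar>s + (c + x) powr (1 / p) + (c - x) powr (1 / p)\<bar> powr p
                  + \<bar>s + (c + x) powr (1 / p) - (c - x) powr (1 / p)\<bar> powr p
                  + \<bar>s - (c + x) powr (1 / p) + (c - x) powr (1 / p)\<bar> powr p
                  + \<bar>s - (c + x) powr (1 / p) - (c - x) powr (1 / p)\<bar> powr p)"
  shows "F t \<le> F t'"
proof (rule DERIV_nonpos_imp_decreasing_open[where f = F, OF t(2)])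
  show "continuous_on {t'..t} F"
  proof -
    have powr: "continuous_on {t'..t} (\<lambda>x. g x powr q)"
      if "continuous_on {t'..t} g" "\<And>x. x \<in> {t'..t} \<Longrightarrow> 0 \<le> g x" "0 < q" for g and q :: real
      using that by (intro continuous_on_powr' continuous_on_const) auto
    have b: "continuous_on {t'..t} (\<lambda>x. (c + x) powr (1 / p))"
      and a: "continuous_on {t'..t} (\<lambda>x. (c - x) powr (1 / p))"
      using p t by (auto intro!: powr continuous_on_add continuous_on_diff continuous_on_const continuous_on_id)
    show ?thesis
      unfolding F_def using p
      by (intro continuous_on_add continuous_on_diff continuous_on_const powr continuous_on_rabs a b) auto
  qed
next
  fix x assume x: "t' < x" "x < t"
  define a where "a = (c - x) powr (1 / p)"
  define b where "b = (c + x) powr (1 / p)"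
  define r where "r = p - 1"
  have r: "1 \<le> r" using p by (simp add: r_def)
  have ab: "0 < a" "a \<le> b" using x t p by (auto simp: a_def b_def intro!: powr_mono2)
  have da: "((\<lambda>x. (c - x) powr (1 / p)) has_field_derivative - (a powr (- r)) / p) (at x)"
  proof (rule DERIV_cong[OF DERIV_fun_powr[of "\<lambda>x. c - x" "- 1"]])
    show "((\<lambda>x. c - x) has_field_derivative - 1) (at x)" by (auto intro!: derivative_eq_intros)
    have "a powr (- r) = (c - x) powr (1 / p - 1)"
      using p by (simp add: a_def r_def powr_powr diff_divide_distrib)
    then show "1 / p * (c - x) powr (1 / p - of_nat 1) * - 1 = - (a powr (- r)) / p" by simp
  qed (use x t in simp)
  have db: "((\<lambda>x. (c + x) powr (1 / p)) has_field_derivative b powr (- r) / p) (at x)"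
  proof (rule DERIV_cong[OF DERIV_fun_powr[of "\<lambda>x. c + x" "1"]])
    show "((\<lambda>x. c + x) has_field_derivative 1) (at x)" by (auto intro!: derivative_eq_intros)
    have "b powr (- r) = (c + x) powr (1 / p - 1)"
      using p by (simp add: b_def r_def powr_powr diff_divide_distrib)
    then show "1 / p * (c + x) powr (1 / p - of_nat 1) * 1 = b powr (- r) / p" by simp
  qed (use x t in simp)
  define S where "S = signed_powr r"
  define B where "B = S (s + b + a) + S (s + b - a) - S (s - b + a) - S (s - b - a)"
  define A where "A = S (s + b + a) - S (s + b - a) + S (s - b + a) - S (s - b - a)"
  have chain: "((\<lambda>x. \<bar>g x\<bar> powr p) has_field_derivative p * S (g x) * D) (at x)"
    if "(g has_field_derivative D) (at x)" for g D
    using DERIV_chain[OF has_field_derivative_abs_powr that, of p] p by (simp add: S_def r_def o_def)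
  have "(F has_field_derivative
      p * S (s + b + a) * (b powr (- r) / p + - (a powr (- r)) / p)
    + p * S (s + b - a) * (b powr (- r) / p - - (a powr (- r)) / p)
    + p * S (s - b + a) * (- (b powr (- r) / p) + - (a powr (- r)) / p)
    + p * S (s - b - a) * (- (b powr (- r) / p) - - (a powr (- r)) / p)) (at x)"
  proof -
    have 1: "((\<lambda>x. s + (c + x) powr (1 / p) + (c - x) powr (1 / p)) has_field_derivative
        (b powr (- r) / p + - (a powr (- r)) / p)) (at x)"
      by (rule DERIV_cong[OF DERIV_add[OF DERIV_add[OF DERIV_const db] da]]) simp
    have 2: "((\<lambda>x. s + (c + x) powr (1 / p) - (c - x) powr (1 / p)) has_field_derivative
        (b powr (- r) / p - - (a powr (- r)) / p)) (at x)"
      by (rule DERIV_cong[OF DERIV_diff[OF DERIV_add[OF DERIV_const db] da]]) simp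
    have 3: "((\<lambda>x. s - (c + x) powr (1 / p) + (c - x) powr (1 / p)) has_field_derivative
        (- (b powr (- r) / p) + - (a powr (- r)) / p)) (at x)"
      by (rule DERIV_cong[OF DERIV_add[OF DERIV_diff[OF DERIV_const db] da]]) simp
    have 4: "((\<lambda>x. s - (c + x) powr (1 / p) - (c - x) powr (1 / p)) has_field_derivative
        (- (b powr (- r) / p) - - (a powr (- r)) / p)) (at x)"
      by (rule DERIV_cong[OF DERIV_diff[OF DERIV_diff[OF DERIV_const db] da]]) simp
    show ?thesis
      using DERIV_add[OF DERIV_add[OF DERIV_add[OF chain[OF 1] chain[OF 2]] chain[OF 3]] chain[OF 4]]
      unfolding F_def by (simp add: a_def b_def)
  qed
  then have "(F has_field_derivative B * b powr (- r) - A * a powr (- r)) (at x)"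
    by (rule DERIV_cong) (use p in \<open>simp add: A_def B_def field_simps\<close>)
  moreover have "B * b powr (- r) \<le> A * a powr (- r)"
    unfolding A_def B_def S_def by (rule pair_smoothing_derivative_sign[OF r ab])
  ultimately show "\<exists>y. (F has_field_derivative y) (at x) \<and> y \<le> 0" by fastforce
qed


section \<open>Sums over signs\<close>

definition sign_sum :: "(real \<Rightarrow> real) \<Rightarrow> 'i set \<Rightarrow> ('i \<Rightarrow> real) \<Rightarrow> real" where
  "sign_sum \<phi> I a = (\<Sum>\<theta>\<in>I \<rightarrow>\<^sub>E {-1, 1}. \<phi> (\<Sum>j\<in>I. \<theta> j * a j))"

lemma sign_sum_empty [simp]: "sign_sum \<phi> {} a = \<phi> 0"
  by (simp add: sign_sum_def)

lemma sum_sign_insert: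
  assumes "finite I" "i \<notin> I"
  shows "(\<Sum>\<theta>\<in>insert i I \<rightarrow>\<^sub>E {-1, 1::real}. g \<theta>) = (\<Sum>\<theta>\<in>I \<rightarrow>\<^sub>E {-1, 1}. g (\<theta>(i := 1)) + g (\<theta>(i := -1)))"
proof -
  have "(\<Sum>\<theta>\<in>insert i I \<rightarrow>\<^sub>E {-1, 1::real}. g \<theta>)
      = (\<Sum>(y, \<theta>)\<in>{-1, 1} \<times> (I \<rightarrow>\<^sub>E {-1, 1}). g (\<theta>(i := y)))"
    unfolding PiE_insert_eq
    by (subst sum.reindex[OF inj_combinator[OF assms(2)]]) (simp add: case_prod_unfold o_def)
  also have "\<dots> = (\<Sum>y\<in>{-1, 1}. \<Sum>\<theta>\<in>I \<rightarrow>\<^sub>E {-1, 1}. g (\<theta>(i := y)))"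
    by (simp add: sum.cartesian_product)
  finally show ?thesis by (simp add: sum.distrib add.commute)
qed

text \<open>
  The recursion behind all computations with these sums: one coordinate is absorbed into the function.
  This is why the inductions below generalise over the function.
\<close>

lemma sign_sum_insert:
  assumes "finite I" "i \<notin> I"
  shows "sign_sum \<phi> (insert i I) a = sign_sum (\<lambda>y. \<phi> (y + a i)) I a + sign_sum (\<lambda>y. \<phi> (y - a i)) I a"
proof -
  have upd: "(\<Sum>j\<in>I. (\<theta>(i := y)) j * a j) = (\<Sum>j\<in>I. \<theta> j * a j)" for \<theta> and y :: real
    using assms by (intro sum.cong) auto
  show ?thesis
    using assms upd unfolding sign_sum_def
    by (simp add: sum_sign_insert sum.distrib add.commute del: fun_upd_apply) (simp add: algebra_simps)
qed

lemma sign_sum_cong: "(\<And>j. j \<in> I \<Longrightarrow> a j = b j) \<Longrightarrow> sign_sum \<phi> I a = sign_sum \<phi> I b"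
  unfolding sign_sum_def by (intro sum.cong refl arg_cong[of _ _ \<phi>]) auto

lemma sign_sum_mono: "(\<And>y. \<phi> y \<le> \<psi> y) \<Longrightarrow> sign_sum \<phi> I a \<le> sign_sum \<psi> I a"
  unfolding sign_sum_def by (intro sum_mono)

lemma sign_sum_add: "sign_sum (\<lambda>y. \<phi> y + \<psi> y) I a = sign_sum \<phi> I a + sign_sum \<psi> I a"
  by (simp add: sign_sum_def sum.distrib)

lemma sign_sum_uminus:
  assumes "finite I"
  shows "sign_sum (\<lambda>y. \<phi> (- y)) I a = sign_sum \<phi> I a"
  using assms
proof (induction I arbitrary: \<phi>)
  case (insert i I)
  show ?case
    using insert.IH[of "\<lambda>y. \<phi> (y + a i)"] insert.IH[of "\<lambda>y. \<phi> (y - a i)"] insert.hyps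
    by (simp add: sign_sum_insert add.commute)
qed simp

lemma sign_sum_abs:
  assumes "finite I"
  shows "sign_sum \<phi> I (\<lambda>j. \<bar>a j\<bar>) = sign_sum \<phi> I a"
  using assms
proof (induction I arbitrary: \<phi>)
  case (insert i I)
  then show ?case by (simp add: sign_sum_insert abs_if)
qed simp

text \<open>
  For even \<open>\<phi>\<close> a global change of sign is harmless, so one sign may be fixed. This links the sums over
  \<open>\<theta>\<^sub>2, \<dots>, \<theta>\<^sub>n\<close> of the quotient with the symmetric sums over all signs.
\<close>

lemma sign_sum_insert_even:
  assumes "finite I" "i \<notin> I" and even: "\<And>y. \<phi> (- y) = \<phi> y"
  shows "sign_sum \<phi> (insert i I) a = 2 * sign_sum (\<lambda>y. \<phi> (a i + y)) I a"
proof -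
  have "\<phi> (- y - a i) = \<phi> (a i + y)" for y
    using even[of "a i + y"] by (simp add: algebra_simps)
  then have "sign_sum (\<lambda>y. \<phi> (y - a i)) I a = sign_sum (\<lambda>y. \<phi> (a i + y)) I a"
    using sign_sum_uminus[OF assms(1), of "\<lambda>y. \<phi> (y - a i)" a] by simp
  then show ?thesis using assms(1,2) by (simp add: sign_sum_insert add.commute)
qed

text \<open>
  Orthogonality of the signs: the mixed terms cancel.
\<close>

lemma sign_sum_power2:
  assumes "finite I"
  shows "sign_sum (\<lambda>y. (c + y)\<^sup>2) I a = 2 ^ card I * (c\<^sup>2 + (\<Sum>j\<in>I. (a j)\<^sup>2))"
  using assms
proof (induction I arbitrary: c)
  case (insert i I)
  have "sign_sum (\<lambda>y. (c + y)\<^sup>2) (insert i I) a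
      = sign_sum (\<lambda>y. ((c + a i) + y)\<^sup>2) I a + sign_sum (\<lambda>y. ((c - a i) + y)\<^sup>2) I a"
    unfolding sign_sum_insert[OF insert.hyps] by (simp only: add_diff_eq diff_add_eq add.assoc add.commute[of "a i"])
  also have "\<dots> = 2 ^ card (insert i I) * (c\<^sup>2 + (\<Sum>j\<in>insert i I. (a j)\<^sup>2))"
    unfolding insert.IH using insert.hyps by (simp add: algebra_simps power2_eq_square)
  finally show ?case .
qed simp

text \<open>
  Grouping by the number \<open>k\<close> of negative signs; the induction step is Pascal's rule.
\<close>

lemma sign_sum_ones:
  assumes "finite I"
  shows "sign_sum \<phi> I (\<lambda>_. 1) = (\<Sum>k\<le>card I. real (card I choose k) * \<phi> (real (card I) - 2 * real k))"
  using assms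
proof (induction I arbitrary: \<phi>)
  case (insert i I)
  let ?m = "card I"
  have "sign_sum \<phi> (insert i I) (\<lambda>_. 1)
      = (\<Sum>k\<le>?m. real (?m choose k) * \<phi> (real ?m + 1 - 2 * real k))
        + (\<Sum>k\<le>?m. real (?m choose k) * \<phi> (real ?m + 1 - 2 * real (Suc k)))"
    using insert by (simp add: sign_sum_insert algebra_simps)
  also have "(\<Sum>k\<le>?m. real (?m choose k) * \<phi> (real ?m + 1 - 2 * real k))
      = (\<Sum>k\<le>Suc ?m. real (?m choose k) * \<phi> (real ?m + 1 - 2 * real k))"
    by simp
  also have "\<dots> = \<phi> (real ?m + 1) + (\<Sum>k\<le>?m. real (?m choose Suc k) * \<phi> (real ?m + 1 - 2 * real (Suc k)))"
    by (subst sum.atMost_Suc_shift) simp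
  also have "\<dots> + (\<Sum>k\<le>?m. real (?m choose k) * \<phi> (real ?m + 1 - 2 * real (Suc k)))
      = (\<Sum>k\<le>Suc ?m. real (Suc ?m choose k) * \<phi> (real ?m + 1 - 2 * real k))"
    unfolding sum.atMost_Suc_shift by (simp add: sum.distrib algebra_simps)
  finally show ?case using insert.hyps by (simp add: add.commute)
qed simp

text \<open>
  The sum over \<open>k \<le> n\<close> is symmetric under \<open>k \<mapsto> n - k\<close>, and a middle term \<open>2 k = n\<close> is \<open>0\<close>, so the sum over
  all \<open>n\<close> signs is twice the one over \<open>k \<le> n / 2\<close>; fixing one sign halves it.
\<close>

lemma sign_sum_one_plus_eq:
  assumes n: "1 \<le> n"
  shows "sign_sum (\<lambda>y. \<bar>1 + y\<bar> powr p) {2..n} (\<lambda>_. 1)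
       = (\<Sum>k=0..nat \<lfloor>real n / 2\<rfloor>. real (n choose k) * (real n - 2 * real k) powr p)"
proof -
  define F where "F = (\<lambda>k. real (n choose k) * \<bar>real n - 2 * real k\<bar> powr p)"
  have ins: "{1..n} = insert 1 {2..n}" using n by auto
  have "2 * sign_sum (\<lambda>y. \<bar>1 + y\<bar> powr p) {2..n} (\<lambda>_. 1) = sign_sum (\<lambda>y. \<bar>y\<bar> powr p) {1..n} (\<lambda>_. 1)"
    unfolding ins by (subst sign_sum_insert_even) auto
  also have "\<dots> = (\<Sum>k\<le>n. F k)" by (subst sign_sum_ones) (auto simp: F_def)
  also have "\<dots> = (\<Sum>k\<in>{k. 2 * k < n}. F k) + (\<Sum>k\<in>{k. k \<le> n \<and> n < 2 * k}. F k)"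
  proof -
    have "(\<Sum>k\<le>n. F k) = (\<Sum>k\<in>{k. 2 * k < n} \<union> {k. k \<le> n \<and> n < 2 * k}. F k)"
      by (rule sum.mono_neutral_right) (auto simp: F_def not_less order_antisym)
    also have "\<dots> = (\<Sum>k\<in>{k. 2 * k < n}. F k) + (\<Sum>k\<in>{k. k \<le> n \<and> n < 2 * k}. F k)"
      by (rule sum.union_disjoint) (auto intro: finite_subset[of _ "{..n}"])
    finally show ?thesis .
  qed
  also have "(\<Sum>k\<in>{k. k \<le> n \<and> n < 2 * k}. F k) = (\<Sum>k\<in>{k. 2 * k < n}. F k)"
  proof (rule sum.reindex_bij_witness[of _ "\<lambda>k. n - k" "\<lambda>k. n - k"])
    fix k assume "k \<in> {k. k \<le> n \<and> n < 2 * k}"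
    then have k: "k \<le> n" by simp
    have "\<bar>real n - 2 * real (n - k)\<bar> = \<bar>real n - 2 * real k\<bar>" using k by (simp add: of_nat_diff)
    moreover have "real (n choose (n - k)) = real (n choose k)" using binomial_symmetric[OF k] by simp
    ultimately show "F (n - k) = F k"
      unfolding F_def by (simp only:)
  qed auto
  also have "(\<Sum>k\<in>{k. 2 * k < n}. F k) = (\<Sum>k\<in>{0..n div 2}. F k)"
    by (rule sum.mono_neutral_left) (auto simp: F_def)
  also have "\<dots> = (\<Sum>k=0..n div 2. real (n choose k) * (real n - 2 * real k) powr p)"
    by (intro sum.cong) (auto simp: F_def)
  also have "n div 2 = nat \<lfloor>real n / 2\<rfloor>" using floor_divide_of_nat_eq[of n 2, where 'a = real] by simp
  finally show ?thesis by simp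
qed

lemma sign_sum_abs_powr_scale:
  "sign_sum (\<lambda>y. \<bar>y\<bar> powr p) I (\<lambda>j. w * a j) = \<bar>w\<bar> powr p * sign_sum (\<lambda>y. \<bar>y\<bar> powr p) I a"
proof -
  have "\<bar>\<Sum>j\<in>I. \<theta> j * (w * a j)\<bar> powr p = \<bar>w\<bar> powr p * \<bar>\<Sum>j\<in>I. \<theta> j * a j\<bar> powr p" for \<theta>
    by (simp add: mult.left_commute abs_mult powr_mult flip: sum_distrib_left)
  then show ?thesis by (simp add: sign_sum_def sum_distrib_left)
qed

text \<open>
  Freeze the signs of the coordinates other than \<open>i\<close> and \<open>k\<close>: for each choice, \<open>pair_smoothing\<close>
  compares the four remaining terms, with \<open>s\<close> the contribution of the frozen coordinates.
\<close>

lemma sign_sum_powr_transfer: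
  fixes b :: "'i \<Rightarrow> real"
  assumes p: "2 \<le> p" and I: "finite I" "i \<in> I" "k \<in> I" "i \<noteq> k"
    and t: "0 \<le> t" "2 * t \<le> b k - b i" and nonneg: "0 \<le> b i"
  shows "sign_sum (\<lambda>y. \<bar>y\<bar> powr p) I (\<lambda>j. b j powr (1 / p))
       \<le> sign_sum (\<lambda>y. \<bar>y\<bar> powr p) I (\<lambda>j. (b(i := b i + t, k := b k - t)) j powr (1 / p))"
proof -
  define J where "J = I - {i, k}"
  have J: "finite J" "i \<notin> J" "k \<notin> insert i J" and I_eq: "I = insert k (insert i J)"
    using I by (auto simp: J_def)
  define quad where "quad = (\<lambda>u v y. \<bar>y + u + v\<bar> powr p + \<bar>y + u - v\<bar> powr p + \<bar>y - u + v\<bar> powr p + \<bar>y - u - v\<bar> powr p)"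
  have split: "sign_sum (\<lambda>y. \<bar>y\<bar> powr p) I a = sign_sum (quad (a k) (a i)) J a" for a
    unfolding I_eq quad_def using J by (simp add: sign_sum_insert sign_sum_add algebra_simps)
  \<comment> \<open>centre and half-distance of the two coordinates, the parameters of \<open>pair_smoothing\<close>\<close>
  define c where "c = (b i + b k) / 2"
  define d where "d = (b k - b i) / 2"
  have "quad (b k powr (1 / p)) (b i powr (1 / p)) y \<le> quad ((b k - t) powr (1 / p)) ((b i + t) powr (1 / p)) y" for y
  proof -
    have e: "c + d = b k" "c - d = b i" "c + (d - t) = b k - t" "c - (d - t) = b i + t"
      by (simp_all add: c_def d_def field_simps)
    have "2 * d = b k - b i" "2 * c = b i + b k" by (simp_all add: c_def d_def)
    then have "0 \<le> d - t" "d - t \<le> d" "d \<le> c" using t nonneg by simp_all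
    from pair_smoothing[OF p this, of y] show ?thesis unfolding e quad_def .
  qed
  then have "sign_sum (quad (b k powr (1 / p)) (b i powr (1 / p))) J (\<lambda>j. b j powr (1 / p))
      \<le> sign_sum (quad ((b k - t) powr (1 / p)) ((b i + t) powr (1 / p))) J (\<lambda>j. b j powr (1 / p))"
    by (rule sign_sum_mono)
  also have "\<dots> = sign_sum (quad ((b k - t) powr (1 / p)) ((b i + t) powr (1 / p))) J (\<lambda>j. (b(i := b i + t, k := b k - t)) j powr (1 / p))"
    using J by (intro sign_sum_cong) auto
  finally show ?thesis using I(4) by (simp add: split)
qed

text \<open>
  Finitely many transfers suffice. As long as some coordinate differs from the mean \<open>m\<close>, one lies below and
  one above it; the largest transfer that does not overshoot makes one of them equal to \<open>m\<close>, so the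
  number of coordinates different from \<open>m\<close> decreases.
\<close>

lemma sign_sum_powr_le_equal:
  fixes b :: "'i \<Rightarrow> real"
  assumes p: "2 \<le> p" and I: "finite I" and nonneg: "\<And>j. j \<in> I \<Longrightarrow> 0 \<le> b j"
    and mean: "(\<Sum>j\<in>I. b j) = real (card I) * m"
  shows "sign_sum (\<lambda>y. \<bar>y\<bar> powr p) I (\<lambda>j. b j powr (1 / p))
       \<le> sign_sum (\<lambda>y. \<bar>y\<bar> powr p) I (\<lambda>j. m powr (1 / p))"
  using nonneg mean
proof (induction "card {j \<in> I. b j \<noteq> m}" arbitrary: b rule: less_induct)
  case less
  show ?case
  proof (cases "\<forall>j\<in>I. b j = m")
    case True
    then show ?thesis by (intro eq_refl sign_sum_cong) simp
  next
    case False
    have dev: "(\<Sum>j\<in>I. b j - m) = 0" using less.prems(2) by (simp add: sum_subtractf)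
    obtain i where i: "i \<in> I" "b i < m"
    proof (rule ccontr)
      assume "\<not> thesis"
      then have "\<And>j. j \<in> I \<Longrightarrow> 0 \<le> b j - m" using that by force
      with dev I have "\<forall>j\<in>I. b j - m = 0" by (simp add: sum_nonneg_eq_0_iff)
      then show False using False by auto
    qed
    obtain k where k: "k \<in> I" "m < b k"
    proof (rule ccontr)
      assume "\<not> thesis"
      then have "\<And>j. j \<in> I \<Longrightarrow> 0 \<le> m - b j" using that by force
      moreover have "(\<Sum>j\<in>I. m - b j) = 0" using dev by (simp add: sum_subtractf)
      ultimately have "\<forall>j\<in>I. m - b j = 0" using I by (simp add: sum_nonneg_eq_0_iff)
      then show False using False by auto
    qed
    have ik: "i \<noteq> k" using i k by auto
    define t where "t = min (m - b i) (b k - m)"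
    define b' where "b' = b(i := b i + t, k := b k - t)"
    have t: "0 \<le> t" "2 * t \<le> b k - b i" using i k by (auto simp: t_def min_def)
    have "{j \<in> I. b' j \<noteq> m} \<subset> {j \<in> I. b j \<noteq> m}"
    proof (rule psubsetI)
      show "{j \<in> I. b' j \<noteq> m} \<subseteq> {j \<in> I. b j \<noteq> m}"
        using i k by (auto simp: b'_def)
      have "b' i = m \<or> b' k = m" using ik by (auto simp: b'_def t_def min_def)
      then show "{j \<in> I. b' j \<noteq> m} \<noteq> {j \<in> I. b j \<noteq> m}" using i k by force
    qed
    then have fewer: "card {j \<in> I. b' j \<noteq> m} < card {j \<in> I. b j \<noteq> m}"
      using I by (intro psubset_card_mono) auto
    have "0 \<le> b' j" if "j \<in> I" for j
      using less.prems(1)[OF that] less.prems(1)[OF i(1)] t i k ik by (auto simp: b'_def)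
    moreover have "(\<Sum>j\<in>I. b' j) = real (card I) * m"
    proof -
      have "(\<Sum>j\<in>I. b' j) = (\<Sum>j\<in>I. b j + ((if j = i then t else 0) - (if j = k then t else 0)))"
        using ik by (intro sum.cong) (auto simp: b'_def)
      also have "\<dots> = (\<Sum>j\<in>I. b j)"
        using I i k by (simp add: sum.distrib sum_subtractf)
      finally show ?thesis using less.prems(2) by simp
    qed
    ultimately have "sign_sum (\<lambda>y. \<bar>y\<bar> powr p) I (\<lambda>j. b' j powr (1 / p)) \<le> sign_sum (\<lambda>y. \<bar>y\<bar> powr p) I (\<lambda>j. m powr (1 / p))"
      by (rule less.hyps[OF fewer])
    with sign_sum_powr_transfer[where b = b, OF p I i(1) k(1) ik t less.prems(1)[OF i(1)]]
    show ?thesis unfolding b'_def by simp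
  qed
qed

text \<open>
  The real inequality behind the case \<open>p > 2\<close>. Both sides are homogeneous of degree \<open>p\<close>, so this is
  the comparison with equal moduli, rescaled.
\<close>

lemma sign_sum_powr_le:
  fixes a :: "'i \<Rightarrow> real"
  assumes p: "2 \<le> p" and I: "finite I" "I \<noteq> {}"
  shows "sign_sum (\<lambda>y. \<bar>y\<bar> powr p) I a
       \<le> (\<Sum>j\<in>I. \<bar>a j\<bar> powr p) / real (card I) * sign_sum (\<lambda>y. \<bar>y\<bar> powr p) I (\<lambda>_. 1)"
proof -
  define m where "m = (\<Sum>j\<in>I. \<bar>a j\<bar> powr p) / real (card I)"
  have m: "0 \<le> m" unfolding m_def by (intro divide_nonneg_nonneg sum_nonneg) auto
  have "sign_sum (\<lambda>y. \<bar>y\<bar> powr p) I a = sign_sum (\<lambda>y. \<bar>y\<bar> powr p) I (\<lambda>j. (\<bar>a j\<bar> powr p) powr (1 / p))"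
    using p by (simp add: powr_powr sign_sum_abs I)
  also have "\<dots> \<le> sign_sum (\<lambda>y. \<bar>y\<bar> powr p) I (\<lambda>j. m powr (1 / p))"
    using I by (intro sign_sum_powr_le_equal p) (auto simp: m_def)
  also have "\<dots> = m * sign_sum (\<lambda>y. \<bar>y\<bar> powr p) I (\<lambda>_. 1)"
    using sign_sum_abs_powr_scale[of p I "m powr (1 / p)" "\<lambda>_. 1"] m p by (simp add: powr_powr)
  finally show ?thesis by (simp add: m_def)
qed


section \<open>Upper bounds for unit functions\<close>

lemma Lp_fun_norm_nonneg: "0 \<le> Lp_fun_norm p M f"
  by (simp add: Lp_fun_norm_def)

lemma Lp_fun_norm_powr:
  assumes "0 < p" shows "Lp_fun_norm p M f powr p = (\<integral>t. \<bar>f t\<bar> powr p \<partial>M)"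
  using assms by (simp add: Lp_fun_norm_def powr_powr)

lemma Lp_fun_norm_power2:
  "(Lp_fun_norm p M f)\<^sup>2 = (\<integral>t. \<bar>f t\<bar> powr p \<partial>M) powr (2 / p)"
  by (simp add: Lp_fun_norm_def powr_powr flip: powr_numeral)

lemma Lp_fun_sum:
  assumes "0 \<le> p" "finite I" "\<And>j. j \<in> I \<Longrightarrow> f j \<in> Lp_fun p M"
  shows "(\<lambda>t. \<Sum>j\<in>I. f j t) \<in> Lp_fun p M"
  using assms(2,3) by (induction I) (auto intro!: Lp_fun_add assms(1) simp: Lp_fun_zero)

text \<open>
  Minkowski's inequality between the quadratic mean over \<open>T\<close> and the \<open>p\<close>-norm, in the usual way: for
  \<open>w\<^sub>\<theta> = \<parallel>g\<^sub>\<theta>\<parallel>\<^sup>2\<close> and \<open>N = \<Sum>w\<^sub>\<theta>\<close>, write \<open>N\<close> as the integral of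
  \<open>\<Sum>w\<^sub>\<theta>\<^sup>1\<^sup>-\<^sup>p\<^sup>/\<^sup>2 \<bar>g\<^sub>\<theta>\<bar>\<^sup>p\<close>, apply Hoelder's inequality pointwise, and divide by \<open>N\<^sup>1\<^sup>-\<^sup>p\<^sup>/\<^sup>2\<close>. The
  function \<open>h\<close> stands for any integrable bound of \<open>(\<Sum>g\<^sub>\<theta>\<^sup>2)\<^sup>p\<^sup>/\<^sup>2\<close>.
\<close>

lemma sum_Lp_fun_norm_power2_le:
  assumes p: "1 \<le> p" "p \<le> 2" and T: "finite T" and g: "\<And>\<theta>. \<theta> \<in> T \<Longrightarrow> g \<theta> \<in> Lp_fun p M"
    and h: "integrable M h" "\<And>t. t \<in> space M \<Longrightarrow> (\<Sum>\<theta>\<in>T. (g \<theta> t)\<^sup>2) powr (p / 2) \<le> h t"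
  shows "(\<Sum>\<theta>\<in>T. (Lp_fun_norm p M (g \<theta>))\<^sup>2) \<le> (\<integral>t. h t \<partial>M) powr (2 / p)"
proof -
  define w where "w = (\<lambda>\<theta>. (Lp_fun_norm p M (g \<theta>))\<^sup>2)"
  define N where "N = (\<Sum>\<theta>\<in>T. w \<theta>)"
  have w: "0 \<le> w \<theta>" for \<theta> by (simp add: w_def)
  have N: "0 \<le> N" using w by (simp add: N_def sum_nonneg)
  have h0: "0 \<le> (\<integral>t. h t \<partial>M)"
    by (rule integral_nonneg_AE, rule AE_I2) (use h(2) order_trans[OF powr_ge_zero] in blast)
  have int: "integrable M (\<lambda>t. \<bar>g \<theta> t\<bar> powr p)" if "\<theta> \<in> T" for \<theta>
    using g[OF that] by (simp add: Lp_fun_def)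
  have mass: "w \<theta> powr (1 - p / 2) * (\<integral>t. \<bar>g \<theta> t\<bar> powr p \<partial>M) = w \<theta>" for \<theta>
  proof -
    have *: "w \<theta> powr (p / 2) = (\<integral>t. \<bar>g \<theta> t\<bar> powr p \<partial>M)"
      using p by (simp add: w_def Lp_fun_norm_power2 powr_powr)
    then show ?thesis unfolding *[symmetric] using w[of \<theta>] by (cases "w \<theta> = 0") (auto simp flip: powr_add)
  qed
  have "N = (\<Sum>\<theta>\<in>T. w \<theta> powr (1 - p / 2) * (\<integral>t. \<bar>g \<theta> t\<bar> powr p \<partial>M))"
    by (simp add: N_def mass)
  also have "\<dots> = (\<integral>t. (\<Sum>\<theta>\<in>T. w \<theta> powr (1 - p / 2) * \<bar>g \<theta> t\<bar> powr p) \<partial>M)"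
    using int by simp
  also have "\<dots> \<le> (\<integral>t. N powr (1 - p / 2) * h t \<partial>M)"
  proof (rule integral_mono)
    fix t assume t: "t \<in> space M"
    have "(\<Sum>\<theta>\<in>T. w \<theta> powr (1 - p / 2) * \<bar>g \<theta> t\<bar> powr p)
        = (\<Sum>\<theta>\<in>T. w \<theta> powr (1 - p / 2) * ((g \<theta> t)\<^sup>2) powr (p / 2))"
      by (simp add: power2_powr_half)
    also have "\<dots> \<le> N powr (1 - p / 2) * (\<Sum>\<theta>\<in>T. (g \<theta> t)\<^sup>2) powr (p / 2)"
      unfolding N_def using p w by (intro sum_powr_mult_powr_le T) auto
    also have "\<dots> \<le> N powr (1 - p / 2) * h t"
      using h(2)[OF t] by (intro mult_left_mono) auto
    finally show "(\<Sum>\<theta>\<in>T. w \<theta> powr (1 - p / 2) * \<bar>g \<theta> t\<bar> powr p) \<le> N powr (1 - p / 2) * h t" .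
  qed (use int h(1) in auto)
  also have "\<dots> = N powr (1 - p / 2) * (\<integral>t. h t \<partial>M)" by simp
  finally have *: "N \<le> N powr (1 - p / 2) * (\<integral>t. h t \<partial>M)" .
  have "N powr (p / 2) \<le> (\<integral>t. h t \<partial>M)"
  proof (cases "N = 0")
    case False
    then have "N = N powr (1 - p / 2) * N powr (p / 2)" "0 < N powr (1 - p / 2)"
      using N by (auto simp flip: powr_add)
    then show ?thesis using * by (metis mult_le_cancel_left_pos)
  qed (use h0 p in simp)
  then have "(N powr (p / 2)) powr (2 / p) \<le> (\<integral>t. h t \<partial>M) powr (2 / p)"
    using p by (intro powr_mono2) auto
  then show ?thesis using p N by (simp add: N_def w_def powr_powr)
qed

text \<open>
  The square function \<open>\<Sum>\<^sub>\<theta> g\<^sub>\<theta>\<^sup>2\<close> is \<open>2\<^sup>\<bar>\<^sup>I\<^sup>\<bar> \<Sum>x\<^sub>j\<^sup>2\<close> by orthogonality, and its power \<open>p / 2 \<le> 1\<close> is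
  subadditive in the \<open>x\<^sub>j\<^sup>2\<close>.
\<close>

lemma sum_signs_norm_power2_le_of_p_le_2:
  assumes p: "1 \<le> p" "p \<le> 2" and I: "finite I" "i \<notin> I"
    and x: "\<And>j. j \<in> insert i I \<Longrightarrow> x j \<in> Lp_fun p M"
    and unit: "\<And>j. j \<in> insert i I \<Longrightarrow> (\<integral>t. \<bar>x j t\<bar> powr p \<partial>M) = 1"
  shows "(\<Sum>\<theta>\<in>I \<rightarrow>\<^sub>E {-1, 1}. (Lp_fun_norm p M (\<lambda>t. x i t + (\<Sum>j\<in>I. \<theta> j * x j t)))\<^sup>2)
       \<le> 2 ^ card I * real (card (insert i I)) powr (2 / p)"
proof -
  define h where "h = (\<lambda>t. (2 ^ card I) powr (p / 2) * (\<Sum>j\<in>insert i I. \<bar>x j t\<bar> powr p))"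
  have int: "integrable M (\<lambda>t. \<bar>x j t\<bar> powr p)" if "j \<in> insert i I" for j
    using x[OF that] by (simp add: Lp_fun_def)
  have "(\<Sum>\<theta>\<in>I \<rightarrow>\<^sub>E {-1, 1}. (Lp_fun_norm p M (\<lambda>t. x i t + (\<Sum>j\<in>I. \<theta> j * x j t)))\<^sup>2)
      \<le> (\<integral>t. h t \<partial>M) powr (2 / p)"
  proof (rule sum_Lp_fun_norm_power2_le[OF p])
    show "finite (I \<rightarrow>\<^sub>E {-1, 1::real})" using I by (intro finite_PiE) auto
    show "(\<lambda>t. x i t + (\<Sum>j\<in>I. \<theta> j * x j t)) \<in> Lp_fun p M" for \<theta>
      using p I x by (intro Lp_fun_add Lp_fun_sum Lp_fun_scale) auto
    show "integrable M h"
      unfolding h_def by (intro integrable_mult_right Bochner_Integration.integrable_sum int)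
    fix t
    have "(\<Sum>\<theta>\<in>I \<rightarrow>\<^sub>E {-1, 1}. (x i t + (\<Sum>j\<in>I. \<theta> j * x j t))\<^sup>2) = 2 ^ card I * (\<Sum>j\<in>insert i I. (x j t)\<^sup>2)"
      using sign_sum_power2[OF I(1), of "x i t" "\<lambda>j. x j t"] I by (simp add: sign_sum_def)
    moreover have "(\<Sum>j\<in>insert i I. (x j t)\<^sup>2) powr (p / 2) \<le> (\<Sum>j\<in>insert i I. ((x j t)\<^sup>2) powr (p / 2))"
      using p I by (intro sum_powr_subadditive) auto
    ultimately show "(\<Sum>\<theta>\<in>I \<rightarrow>\<^sub>E {-1, 1}. (x i t + (\<Sum>j\<in>I. \<theta> j * x j t))\<^sup>2) powr (p / 2) \<le> h t"
      by (simp add: h_def powr_mult power2_powr_half)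
  qed
  also have "(\<integral>t. h t \<partial>M) = (2 ^ card I) powr (p / 2) * real (card (insert i I))"
    unfolding h_def using int unit by simp
  also have "\<dots> powr (2 / p) = 2 ^ card I * real (card (insert i I)) powr (2 / p)"
    using p by (simp add: powr_mult powr_powr)
  finally show ?thesis .
qed

text \<open>
  After Jensen's inequality the \<open>p\<close>-th powers of the norms may be summed under the integral, where
  \<open>sign_sum_powr_le\<close> applies at every point. Its right side is linear in the \<open>\<bar>x\<^sub>j\<bar>\<^sup>p\<close>, so it integrates to a
  number that depends only on the norms.
\<close>

lemma sum_signs_norm_power2_le_of_p_ge_2:
  assumes p: "2 \<le> p" and I: "finite I" "i \<notin> I"
    and x: "\<And>j. j \<in> insert i I \<Longrightarrow> x j \<in> Lp_fun p M"
    and unit: "\<And>j. j \<in> insert i I \<Longrightarrow> (\<integral>t. \<bar>x j t\<bar> powr p \<partial>M) = 1"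
  shows "(\<Sum>\<theta>\<in>I \<rightarrow>\<^sub>E {-1, 1}. (Lp_fun_norm p M (\<lambda>t. x i t + (\<Sum>j\<in>I. \<theta> j * x j t)))\<^sup>2)
       \<le> 2 ^ card I * (sign_sum (\<lambda>y. \<bar>1 + y\<bar> powr p) I (\<lambda>_. 1) / 2 ^ card I) powr (2 / p)"
proof -
  let ?T = "I \<rightarrow>\<^sub>E {-1, 1::real}"
  let ?g = "\<lambda>\<theta> t. x i t + (\<Sum>j\<in>I. \<theta> j * x j t)"
  let ?S = "\<lambda>a. sign_sum (\<lambda>y. \<bar>y\<bar> powr p) (insert i I) a"
  let ?n = "real (card (insert i I))"
  have T: "finite ?T" "?T \<noteq> {}" "real (card ?T) = 2 ^ card I"
    using I by (auto intro!: finite_PiE simp: card_PiE PiE_eq_empty_iff)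
  have g: "?g \<theta> \<in> Lp_fun p M" for \<theta>
    using p I x by (intro Lp_fun_add Lp_fun_sum Lp_fun_scale) auto
  have intg: "integrable M (\<lambda>t. \<bar>?g \<theta> t\<bar> powr p)" for \<theta>
    using g[of \<theta>] by (simp add: Lp_fun_def)
  have intx: "integrable M (\<lambda>t. \<bar>x j t\<bar> powr p)" if "j \<in> insert i I" for j
    using x[OF that] by (simp add: Lp_fun_def)
  have half: "sign_sum (\<lambda>y. \<bar>a i + y\<bar> powr p) I a = ?S a / 2" for a
    using sign_sum_insert_even[OF I, of "\<lambda>y. \<bar>y\<bar> powr p" a] by simp
  have "(\<Sum>\<theta>\<in>?T. Lp_fun_norm p M (?g \<theta>) powr p) = (\<integral>t. (\<Sum>\<theta>\<in>?T. \<bar>?g \<theta> t\<bar> powr p) \<partial>M)"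
    using p intg by (simp add: Lp_fun_norm_powr)
  also have "\<dots> = (\<integral>t. ?S (\<lambda>j. x j t) / 2 \<partial>M)"
    unfolding half[symmetric] by (simp add: sign_sum_def)
  also have "\<dots> \<le> (\<integral>t. (\<Sum>j\<in>insert i I. \<bar>x j t\<bar> powr p) / ?n * ?S (\<lambda>_. 1) / 2 \<partial>M)"
  proof (rule integral_mono)
    show "integrable M (\<lambda>t. ?S (\<lambda>j. x j t) / 2)"
      unfolding half[symmetric] using intg by (simp add: sign_sum_def)
    show "integrable M (\<lambda>t. (\<Sum>j\<in>insert i I. \<bar>x j t\<bar> powr p) / ?n * ?S (\<lambda>_. 1) / 2)"
      by (intro integrable_divide integrable_mult_left Bochner_Integration.integrable_sum intx)
    fix t
    show "?S (\<lambda>j. x j t) / 2 \<le> (\<Sum>j\<in>insert i I. \<bar>x j t\<bar> powr p) / ?n * ?S (\<lambda>_. 1) / 2"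
      by (intro divide_right_mono sign_sum_powr_le[OF p]) (use I in auto)
  qed
  also have "\<dots> = (\<Sum>j\<in>insert i I. \<integral>t. \<bar>x j t\<bar> powr p \<partial>M) / ?n * ?S (\<lambda>_. 1) / 2"
    using intx by (simp del: sum.insert add: Bochner_Integration.integral_sum)
  also have "\<dots> = ?S (\<lambda>_. 1) / 2"
    using unit I by (simp del: sum.insert card_insert_disjoint)
  finally have "(\<Sum>\<theta>\<in>?T. Lp_fun_norm p M (?g \<theta>) powr p) \<le> ?S (\<lambda>_. 1) / 2" .
  then have mean: "((\<Sum>\<theta>\<in>?T. Lp_fun_norm p M (?g \<theta>) powr p) / 2 ^ card I) powr (2 / p)
      \<le> (?S (\<lambda>_. 1) / 2 / 2 ^ card I) powr (2 / p)"
    using p by (intro powr_mono2 divide_right_mono divide_nonneg_nonneg sum_nonneg) auto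
  have "(\<Sum>\<theta>\<in>?T. (Lp_fun_norm p M (?g \<theta>))\<^sup>2)
      \<le> 2 ^ card I * ((\<Sum>\<theta>\<in>?T. Lp_fun_norm p M (?g \<theta>) powr p) / 2 ^ card I) powr (2 / p)"
    using sum_power2_le_of_sum_powr[OF p T(1,2) Lp_fun_norm_nonneg] unfolding T(3) .
  also have "\<dots> \<le> 2 ^ card I * (?S (\<lambda>_. 1) / 2 / 2 ^ card I) powr (2 / p)"
    by (intro mult_left_mono mean) simp
  also have "?S (\<lambda>_. 1) / 2 = sign_sum (\<lambda>y. \<bar>1 + y\<bar> powr p) I (\<lambda>_. 1)"
    using half[of "\<lambda>_. 1"] by simp
  finally show ?thesis .
qed


section \<open>Dimension and disjoint sets of positive measure\<close>

text \<open>
  Gaussian elimination: solve one equation for a variable and substitute it into the others.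
\<close>

lemma homogeneous_system_nontrivial_solution:
  fixes A :: "'i \<Rightarrow> 'j \<Rightarrow> real"
  assumes "finite I" "finite J" "card I < card J"
  shows "\<exists>x. (\<exists>j\<in>J. x j \<noteq> 0) \<and> (\<forall>i\<in>I. (\<Sum>j\<in>J. A i j * x j) = 0)"
  using assms
proof (induction I arbitrary: J A)
  case empty
  then obtain j where "j \<in> J" by fastforce
  then show ?case by (intro exI[of _ "\<lambda>_. 1"]) auto
next
  case (insert i I)
  show ?case
  proof (cases "\<forall>j\<in>J. A i j = 0")
    case True
    have "card I < card J" using insert by simp
    from insert.IH[OF insert.prems(1) this, of A] obtain x
      where "\<exists>j\<in>J. x j \<noteq> 0" "\<forall>l\<in>I. (\<Sum>j\<in>J. A l j * x j) = 0" by blast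
    then show ?thesis using True by (intro exI[of _ x]) simp
  next
    case False
    then obtain k where k: "k \<in> J" "A i k \<noteq> 0" by blast
    define J' where "J' = J - {k}"
    have J: "J = insert k J'" "k \<notin> J'" "finite J'" using k insert.prems by (auto simp: J'_def)
    have "card I < card J'" using insert J by simp
    from insert.IH[OF J(3) this, of "\<lambda>l j. A l j - A l k * A i j / A i k"]
    obtain x where x: "\<exists>j\<in>J'. x j \<noteq> 0" "\<forall>l\<in>I. (\<Sum>j\<in>J'. (A l j - A l k * A i j / A i k) * x j) = 0"
      by blast
    define y where "y = x(k := - (\<Sum>j\<in>J'. A i j * x j) / A i k)"
    have y: "(\<Sum>j\<in>J. A l j * y j) = (\<Sum>j\<in>J'. A l j * x j) - A l k * (\<Sum>j\<in>J'. A i j * x j) / A i k" for l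
    proof -
      have "(\<Sum>j\<in>J'. A l j * y j) = (\<Sum>j\<in>J'. A l j * x j)"
        using J by (intro sum.cong) (auto simp: y_def)
      then show ?thesis using J by (simp add: y_def)
    qed
    have "(\<Sum>j\<in>J. A l j * y j) = 0" if "l \<in> insert i I" for l
    proof (cases "l = i")
      case True
      then show ?thesis using k by (simp add: y)
    next
      case False
      then have "(\<Sum>j\<in>J'. (A l j - A l k * A i j / A i k) * x j) = 0" using x that by simp
      also have "(\<Sum>j\<in>J'. (A l j - A l k * A i j / A i k) * x j)
          = (\<Sum>j\<in>J'. A l j * x j) - A l k * (\<Sum>j\<in>J'. A i j * x j) / A i k"
        by (simp add: left_diff_distrib sum_subtractf sum_distrib_left sum_divide_distrib mult.assoc)
      finally show ?thesis by (simp add: y)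
    qed
    moreover have "\<exists>j\<in>J. y j \<noteq> 0" using x(1) J by (auto simp: y_def)
    ultimately show ?thesis by blast
  qed
qed

definition disjoint_positive_sets :: "'a measure \<Rightarrow> nat \<Rightarrow> (nat \<Rightarrow> 'a set) \<Rightarrow> bool" where
  "disjoint_positive_sets M k E \<longleftrightarrow>
     disjoint_family_on E {..<k} \<and> (\<forall>i<k. E i \<in> fmeasurable M \<and> 0 < measure M (E i))"

lemma disjoint_positive_sets_Suc:
  assumes E: "disjoint_positive_sets M k E" and A: "A \<in> fmeasurable M" "0 < measure M A"
    and disj: "\<And>i. i < k \<Longrightarrow> A \<inter> E i = {}"
  shows "disjoint_positive_sets M (Suc k) (E(k := A))"
proof -
  have "(E(k := A)) i \<inter> (E(k := A)) j = {}" if ij: "i < Suc k" "j < Suc k" "i \<noteq> j" for i j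
  proof -
    consider "i = k" "j < k" | "j = k" "i < k" | "i < k" "j < k" "i \<noteq> k" "j \<noteq> k"
      using ij unfolding less_Suc_eq by blast
    then show ?thesis
    proof cases
      case 3
      then show ?thesis
        using E ij(3) by (simp add: disjoint_positive_sets_def disjoint_family_on_def)
    qed (use disj in \<open>auto simp: Int_commute\<close>)
  qed
  then show ?thesis
    using E A by (auto simp: disjoint_positive_sets_def disjoint_family_on_def less_Suc_eq)
qed

lemma Lp_fun_level_fmeasurable:
  assumes p: "0 < p" and g: "g \<in> Lp_fun p M" and c: "0 < c"
  shows "{t \<in> space M. c \<le> \<bar>g t\<bar>} \<in> fmeasurable M"
proof (rule fmeasurableI)
  have [measurable]: "g \<in> borel_measurable M" and int: "integrable M (\<lambda>t. \<bar>g t\<bar> powr p)"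
    using g by (auto simp: Lp_fun_def)
  show "{t \<in> space M. c \<le> \<bar>g t\<bar>} \<in> sets M" by measurable
  have "{t \<in> space M. c \<le> \<bar>g t\<bar>} \<subseteq> {t \<in> space M. c powr p \<le> \<bar>g t\<bar> powr p}"
    using p c by (auto intro: powr_mono2)
  then have "emeasure M {t \<in> space M. c \<le> \<bar>g t\<bar>} \<le> emeasure M {t \<in> space M. c powr p \<le> \<bar>g t\<bar> powr p}"
    by (rule emeasure_mono) measurable
  also have "\<dots> \<le> ennreal ((1 / (c powr p)) * (\<integral>t. \<bar>g t\<bar> powr p \<partial>M))"
    using integral_Markov_inequality[OF int, of "c powr p"] c by simp
  also have "\<dots> < \<infinity>" by simp
  finally show "emeasure M {t \<in> space M. c \<le> \<bar>g t\<bar>} < \<infinity>" .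
qed

lemma Lp_fun_integrable_indicator:
  assumes p: "1 \<le> p" and g: "g \<in> Lp_fun p M" and A: "A \<in> fmeasurable M"
  shows "integrable M (\<lambda>t. indicator A t * g t)"
proof -
  have [measurable]: "g \<in> borel_measurable M" "A \<in> sets M" and int: "integrable M (\<lambda>t. \<bar>g t\<bar> powr p)"
    using g A by (auto simp: Lp_fun_def)
  have "integrable M (\<lambda>t. indicator A t + \<bar>g t\<bar> powr p)"
    using A int by (auto simp: fmeasurable_def)
  then show ?thesis
  proof (rule Bochner_Integration.integrable_bound)
    show "AE t in M. norm (indicator A t * g t) \<le> norm (indicator A t + \<bar>g t\<bar> powr p)"
    proof (rule AE_I2)
      fix t
      have "\<bar>g t\<bar> \<le> 1 + \<bar>g t\<bar> powr p"
      proof (cases "\<bar>g t\<bar> \<le> 1")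
        case False
        then have "\<bar>g t\<bar> powr 1 \<le> \<bar>g t\<bar> powr p" using p by (intro powr_mono) auto
        then show ?thesis using False by simp
      qed (simp add: add_increasing2)
      then show "norm (indicator A t * g t) \<le> norm (indicator A t + \<bar>g t\<bar> powr p)"
        by (auto simp: indicator_def abs_mult)
    qed
  qed measurable
qed

text \<open>
  On an atom the set \<open>{g > 0}\<close> is null or conull, and conull would make the integral of \<open>g\<close> positive.
  Applied to \<open>g\<close> and \<open>- g\<close>, this replaces the statement that a measurable function is constant on an atom.
\<close>

lemma AE_nonpos_on_atom:
  fixes g :: "'a \<Rightarrow> real"
  assumes g: "g \<in> borel_measurable M" "integrable M (\<lambda>t. indicator A t * g t)"
    and zero: "(\<integral>t. indicator A t * g t \<partial>M) = 0"
    and A: "A \<in> fmeasurable M" "0 < measure M A"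
    and atom: "\<And>B. B \<in> sets M \<Longrightarrow> B \<subseteq> A \<Longrightarrow> measure M B = 0 \<or> measure M (A - B) = 0"
  shows "AE t in M. t \<in> A \<longrightarrow> g t \<le> 0"
proof -
  note [measurable] = g(1)
  define B where "B = {t \<in> space M. t \<in> A \<and> 0 < g t}"
  have As[measurable]: "A \<in> sets M" using A by auto
  have "B \<in> sets M" unfolding B_def by measurable
  moreover have "B \<subseteq> A" by (auto simp: B_def)
  ultimately have B: "B \<in> sets M" "B \<subseteq> A" .
  have null: "C \<in> null_sets M" if "C \<in> sets M" "C \<subseteq> A" "measure M C = 0" for C
    using that A emeasure_eq_measure2[OF fmeasurableI2[OF A(1)]] by (intro null_setsI) auto
  from atom[OF B] show ?thesis
  proof
    assume "measure M B = 0"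
    then have "AE t in M. t \<notin> B" using null B by (intro AE_not_in) auto
    then show ?thesis by (rule AE_mp) (auto intro!: AE_I2 simp: B_def)
  next
    assume "measure M (A - B) = 0"
    then have "AE t in M. t \<notin> A - B" using null B by (intro AE_not_in) auto
    then have pos: "AE t in M. t \<in> A \<longrightarrow> 0 < g t"
      by (rule AE_mp) (auto intro!: AE_I2 simp: B_def)
    then have "AE t in M. 0 \<le> indicator A t * g t"
      by (rule AE_mp) (auto intro!: AE_I2 simp: indicator_def)
    with zero g(2) have "AE t in M. indicator A t * g t = 0"
      by (simp add: integral_nonneg_eq_0_iff_AE)
    with pos have "AE t in M. t \<notin> A"
      by eventually_elim (auto simp: indicator_def)
    then have "measure M A = 0"
      by (metis As AE_iff_null_sets measure_eq_0_null_sets)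
    then show ?thesis using A(2) by simp
  qed
qed

text \<open>
  Otherwise a largest system of such sets has \<open>k < card B\<close> members. By maximality its members are atoms
  (one that splits could be replaced by its two parts), and every set of finite measure outside them is
  null. With \<open>card B\<close> unknowns and \<open>k\<close> equations there is a nontrivial combination \<open>g\<close> of the functions
  with integral \<open>0\<close> over each atom. Then \<open>g\<close> vanishes on the atoms, and it vanishes outside because its level
  sets \<open>{\<bar>g\<bar> \<ge> 1 / (m + 1)}\<close> have finite measure. This contradicts independence.
\<close>

lemma exists_disjoint_positive_sets:
  fixes f :: "'v \<Rightarrow> 'a \<Rightarrow> real"
  assumes p: "1 \<le> p" and B: "finite B" and f: "\<And>v. v \<in> B \<Longrightarrow> f v \<in> Lp_fun p M"
    and indep: "\<And>a. AE t in M. (\<Sum>v\<in>B. a v * f v t) = 0 \<Longrightarrow> \<forall>v\<in>B. a v = 0"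
  shows "\<exists>E. disjoint_positive_sets M (card B) E"
proof (rule ccontr)
  assume none: "\<not> ?thesis"
  have "\<not> (\<nexists>E. disjoint_positive_sets M 0 E)"
    by (simp add: disjoint_positive_sets_def disjoint_family_on_def)
  from ex_least_nat_less[OF none this]
  obtain k E where k: "k < card B" and E: "disjoint_positive_sets M k E"
    and max: "\<nexists>E. disjoint_positive_sets M (Suc k) E"
    by blast
  have Ei: "E i \<in> fmeasurable M" "0 < measure M (E i)" if "i < k" for i
    using E that by (auto simp: disjoint_positive_sets_def)
  have disj: "E i \<inter> E j = {}" if "i < k" "j < k" "i \<noteq> j" for i j
    using E that by (auto simp: disjoint_positive_sets_def disjoint_family_on_def)
  have outside: "measure M A = 0" if "A \<in> fmeasurable M" "\<And>i. i < k \<Longrightarrow> A \<inter> E i = {}" for A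
  proof (rule ccontr)
    assume "measure M A \<noteq> 0"
    then have "disjoint_positive_sets M (Suc k) (E(k := A))"
      using that by (intro disjoint_positive_sets_Suc E) (auto simp: less_le)
    then show False using max by blast
  qed
  have atom: "measure M A = 0 \<or> measure M (E i - A) = 0" if i: "i < k" and A: "A \<in> sets M" "A \<subseteq> E i" for i A
  proof (rule ccontr)
    assume "\<not> ?thesis"
    then have pos: "0 < measure M A" "0 < measure M (E i - A)" by (simp_all add: less_le)
    have fm: "A \<in> fmeasurable M" "E i - A \<in> fmeasurable M"
      using A Ei[OF i] by (auto intro: fmeasurableI2 fmeasurable_Diff)
    have "(E(i := A)) l \<inter> (E(i := A)) j = {}" if "l < k" "j < k" "l \<noteq> j" for l j
      using disj[OF that] A(2) by (auto split: if_splits)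
    then have "disjoint_positive_sets M k (E(i := A))"
      using Ei pos(1) fm(1) by (auto simp: disjoint_positive_sets_def disjoint_family_on_def)
    moreover have "(E i - A) \<inter> (E(i := A)) j = {}" if "j < k" for j
      using disj[OF i that] by auto
    ultimately have "disjoint_positive_sets M (Suc k) ((E(i := A))(k := E i - A))"
      by (intro disjoint_positive_sets_Suc fm pos)
    then show False using max by blast
  qed
  \<comment> \<open>one equation per atom, one unknown per function\<close>
  obtain a where a: "\<exists>v\<in>B. a v \<noteq> 0"
    and means: "\<forall>i<k. (\<Sum>v\<in>B. (\<integral>t. indicator (E i) t * f v t \<partial>M) * a v) = 0"
    using homogeneous_system_nontrivial_solution[of "{..<k}" B "\<lambda>i v. \<integral>t. indicator (E i) t * f v t \<partial>M"] B k
    by auto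
  define g where "g = (\<lambda>t. \<Sum>v\<in>B. a v * f v t)"
  have "g \<in> Lp_fun p M"
    unfolding g_def using B f p by (intro Lp_fun_sum Lp_fun_scale) auto
  then have g: "g \<in> Lp_fun p M" "g \<in> borel_measurable M" by (auto simp: Lp_fun_def)
  have mean_g: "(\<integral>t. indicator (E i) t * g t \<partial>M) = 0" if "i < k" for i
  proof -
    have "(\<integral>t. indicator (E i) t * g t \<partial>M) = (\<integral>t. (\<Sum>v\<in>B. (indicator (E i) t * f v t) * a v) \<partial>M)"
      by (simp add: g_def sum_distrib_left mult_ac)
    also have "\<dots> = (\<Sum>v\<in>B. (\<integral>t. indicator (E i) t * f v t \<partial>M) * a v)"
      using Lp_fun_integrable_indicator[OF p f Ei(1)[OF that]] by simp
    finally show ?thesis using means that by simp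
  qed
  have on_Ei: "AE t in M. t \<in> E i \<longrightarrow> g t = 0" if "i < k" for i
  proof -
    have int: "integrable M (\<lambda>t. indicator (E i) t * g t)"
      using Lp_fun_integrable_indicator[OF p g(1) Ei(1)[OF that]] .
    have "AE t in M. t \<in> E i \<longrightarrow> g t \<le> 0"
      using mean_g that by (intro AE_nonpos_on_atom[OF g(2) int] Ei atom) auto
    moreover have "AE t in M. t \<in> E i \<longrightarrow> - g t \<le> 0"
      using mean_g that g(2) int by (intro AE_nonpos_on_atom Ei atom) auto
    ultimately show ?thesis by eventually_elim auto
  qed
  have "AE t in M. i < k \<longrightarrow> t \<in> E i \<longrightarrow> g t = 0" for i
    by (cases "i < k") (use on_Ei[of i] in auto)
  then have on: "AE t in M. \<forall>i. i < k \<longrightarrow> t \<in> E i \<longrightarrow> g t = 0"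
    unfolding AE_all_countable ..
  have "AE t in M. t \<notin> (\<Union>i<k. E i) \<longrightarrow> \<bar>g t\<bar> < 1 / real (Suc m)" for m
  proof -
    define A where "A = {t \<in> space M. 1 / real (Suc m) \<le> \<bar>g t\<bar>} - (\<Union>i<k. E i)"
    have "A \<in> fmeasurable M"
      unfolding A_def using Ei(1) p
      by (intro fmeasurable_Diff Lp_fun_level_fmeasurable[OF _ g(1)] sets.finite_UN) auto
    moreover from this have "measure M A = 0" by (rule outside) (auto simp: A_def)
    ultimately have "A \<in> null_sets M"
      using emeasure_eq_measure2[of A M] by (intro null_setsI) auto
    then have "AE t in M. t \<notin> A" by (rule AE_not_in)
    then show ?thesis by (rule AE_mp) (auto intro!: AE_I2 simp: A_def not_le)
  qed
  then have "AE t in M. \<forall>m. t \<notin> (\<Union>i<k. E i) \<longrightarrow> \<bar>g t\<bar> < 1 / real (Suc m)"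
    unfolding AE_all_countable ..
  with on have "AE t in M. g t = 0"
  proof eventually_elim
    case (elim t)
    show ?case
    proof (rule ccontr)
      assume "g t \<noteq> 0"
      then obtain m where "inverse (real (Suc m)) < \<bar>g t\<bar>" using reals_Archimedean[of "\<bar>g t\<bar>"] by auto
      moreover have "t \<notin> (\<Union>i<k. E i)" using elim(1) \<open>g t \<noteq> 0\<close> by blast
      ultimately show False using elim(2)[rule_format, of m] by (simp add: inverse_eq_divide)
    qed
  qed
  with indep[of a] a show False by (auto simp: g_def)
qed


section \<open>Extremal families of step functions\<close>

text \<open>
  The factor \<open>\<mu>(E\<^sub>k)\<^sup>-\<^sup>1\<^sup>/\<^sup>p\<close> normalises the indicator functions, so that \<open>c \<mapsto> step_fun p M E m c\<close> is an
  isometric embedding of \<open>l\<^sup>p\<^sub>m\<close> when the sets are disjoint.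
\<close>

definition step_fun :: "real \<Rightarrow> 'a measure \<Rightarrow> (nat \<Rightarrow> 'a set) \<Rightarrow> nat \<Rightarrow> (nat \<Rightarrow> real) \<Rightarrow> 'a \<Rightarrow> real" where
  "step_fun p M E m c = (\<lambda>t. \<Sum>k<m. c k * measure M (E k) powr (- 1 / p) * indicator (E k) t)"

lemma step_fun_combination:
  "step_fun p M E m c t + (\<Sum>j\<in>I. \<theta> j * step_fun p M E m (d j) t)
    = step_fun p M E m (\<lambda>k. c k + (\<Sum>j\<in>I. \<theta> j * d j k)) t"
proof -
  have "(\<Sum>j\<in>I. \<theta> j * step_fun p M E m (d j) t)
      = (\<Sum>k<m. \<Sum>j\<in>I. \<theta> j * d j k * measure M (E k) powr (- 1 / p) * indicator (E k) t)"
    unfolding step_fun_def sum_distrib_left by (subst sum.swap) (simp add: mult.assoc)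
  then show ?thesis
    by (simp add: step_fun_def sum.distrib algebra_simps sum_distrib_left sum_distrib_right)
qed

lemma step_fun_Lp:
  assumes p: "1 \<le> p" and E: "disjoint_positive_sets M m E"
  shows "step_fun p M E m c \<in> Lp_fun p M"
    and "(\<integral>t. \<bar>step_fun p M E m c t\<bar> powr p \<partial>M) = (\<Sum>k<m. \<bar>c k\<bar> powr p)"
proof -
  have Ek: "E k \<in> fmeasurable M" "0 < measure M (E k)" if "k < m" for k
    using E that by (auto simp: disjoint_positive_sets_def)
  have [measurable]: "E k \<in> sets M" if "k < m" for k using Ek(1)[OF that] by auto
  have disj: "k = l" if "t \<in> E k" "t \<in> E l" "k < m" "l < m" for t k l
    using E that by (auto simp: disjoint_positive_sets_def disjoint_family_on_def)
  have int: "integrable M (indicator (E k) :: _ \<Rightarrow> real)" if "k < m" for k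
    using Ek(1)[OF that] by (auto simp: fmeasurable_def)
  have pw: "\<bar>step_fun p M E m c t\<bar> powr p = (\<Sum>k<m. (\<bar>c k\<bar> powr p / measure M (E k)) * indicator (E k) t)" for t
  proof (cases "\<exists>k<m. t \<in> E k")
    case True
    then obtain l where l: "l < m" "t \<in> E l" by blast
    then have ind: "indicator (E k) t = (if k = l then 1 else 0 :: real)" if "k < m" for k
      using disj that by (auto simp: indicator_def)
    have "step_fun p M E m c t = (\<Sum>k<m. if k = l then c k * measure M (E k) powr (- 1 / p) else 0)"
      unfolding step_fun_def by (intro sum.cong) (auto simp: ind)
    then have "\<bar>step_fun p M E m c t\<bar> powr p = \<bar>c l\<bar> powr p * measure M (E l) powr (- 1)"
      using l p by (simp add: abs_mult powr_mult powr_powr)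
    moreover have "(\<Sum>k<m. (\<bar>c k\<bar> powr p / measure M (E k)) * indicator (E k) t)
        = (\<Sum>k<m. if k = l then \<bar>c k\<bar> powr p / measure M (E k) else 0)"
      by (intro sum.cong) (auto simp: ind)
    ultimately show ?thesis using l Ek(2)[OF l(1)] by (simp add: powr_minus divide_inverse)
  next
    case False
    then have "step_fun p M E m c t = 0"
      unfolding step_fun_def by (intro sum.neutral) auto
    moreover have "(\<Sum>k<m. (\<bar>c k\<bar> powr p / measure M (E k)) * indicator (E k) t) = 0"
      using False by (intro sum.neutral) auto
    ultimately show ?thesis by simp
  qed
  have "step_fun p M E m c \<in> borel_measurable M" unfolding step_fun_def by measurable
  moreover have intp: "integrable M (\<lambda>t. \<bar>step_fun p M E m c t\<bar> powr p)"
    unfolding pw using int by (intro Bochner_Integration.integrable_sum integrable_mult_right) auto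
  ultimately show "step_fun p M E m c \<in> Lp_fun p M" by (simp add: Lp_fun_def)
  have "(\<integral>t. \<bar>step_fun p M E m c t\<bar> powr p \<partial>M) = (\<Sum>k<m. (\<bar>c k\<bar> powr p / measure M (E k)) * measure M (E k))"
    unfolding pw using int Ek(1) by (simp add: sets.Int_space_eq2)
  also have "\<dots> = (\<Sum>k<m. \<bar>c k\<bar> powr p)"
    using Ek(2) by (intro sum.cong) (auto simp: less_imp_neq[symmetric])
  finally show "(\<integral>t. \<bar>step_fun p M E m c t\<bar> powr p \<partial>M) = (\<Sum>k<m. \<bar>c k\<bar> powr p)" .
qed

definition unit_family :: "real \<Rightarrow> 'a measure \<Rightarrow> nat \<Rightarrow> (nat \<Rightarrow> 'a \<Rightarrow> real) \<Rightarrow> bool" where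
  "unit_family p M n f \<longleftrightarrow> (\<forall>j\<in>{1..n}. f j \<in> Lp_fun p M \<and> (\<integral>t. \<bar>f j t\<bar> powr p \<partial>M) = 1)"

definition signed_norm :: "real \<Rightarrow> 'a measure \<Rightarrow> nat \<Rightarrow> (nat \<Rightarrow> 'a \<Rightarrow> real) \<Rightarrow> (nat \<Rightarrow> real) \<Rightarrow> real" where
  "signed_norm p M n f \<theta> = Lp_fun_norm p M (\<lambda>t. f 1 t + (\<Sum>j\<in>{2..n}. \<theta> j * f j t))"

text \<open>
  Transports a family in \<open>l\<^sup>p\<^sub>m\<close>, with columns \<open>c j\<close>, along this embedding.
\<close>

lemma step_fun_family:
  assumes p: "1 \<le> p" and E: "disjoint_positive_sets M m E"
    and unit: "\<And>j. j \<in> {1..n} \<Longrightarrow> (\<Sum>k<m. \<bar>c j k\<bar> powr p) = 1"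
    and comb: "\<And>\<theta>. \<theta> \<in> {2..n} \<rightarrow>\<^sub>E {-1, 1} \<Longrightarrow> (\<Sum>k<m. \<bar>c 1 k + (\<Sum>j\<in>{2..n}. \<theta> j * c j k)\<bar> powr p) = s"
  shows "\<exists>f. unit_family p M n f \<and> (\<forall>\<theta>\<in>{2..n} \<rightarrow>\<^sub>E {-1, 1}. (signed_norm p M n f \<theta>)\<^sup>2 = s powr (2 / p))"
  using step_fun_Lp[OF p E] unit comb
  by (intro exI[of _ "\<lambda>j. step_fun p M E m (c j)"])
     (auto simp: unit_family_def signed_norm_def step_fun_combination Lp_fun_norm_power2)

text \<open>
  The unit vectors of \<open>l\<^sup>p\<^sub>n\<close>: whatever the signs, all \<open>n\<close> entries of the combination have modulus \<open>1\<close>.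
\<close>

lemma extremal_family_of_n_sets:
  assumes p: "1 \<le> p" and n: "1 \<le> n" and E: "disjoint_positive_sets M n E"
  shows "\<exists>f. unit_family p M n f \<and>
    (\<forall>\<theta>\<in>{2..n} \<rightarrow>\<^sub>E {-1, 1}. (signed_norm p M n f \<theta>)\<^sup>2 = real n powr (2 / p))"
proof (rule step_fun_family[where c = "\<lambda>j k. if j = Suc k then 1 else 0", OF p E])
  fix j assume "j \<in> {1..n}"
  then have "(\<Sum>k<n. \<bar>if j = Suc k then 1 else 0\<bar> powr p) = (\<Sum>k<n. if k = j - 1 then 1 else 0)"
    by (intro sum.cong) auto
  moreover have "j - 1 < n" using \<open>j \<in> {1..n}\<close> by auto
  ultimately show "(\<Sum>k<n. \<bar>if j = Suc k then 1 else 0 :: real\<bar> powr p) = 1" by simp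
next
  fix \<theta> :: "nat \<Rightarrow> real" assume \<theta>: "\<theta> \<in> {2..n} \<rightarrow>\<^sub>E {-1, 1}"
  have entry: "\<bar>(if 1 = Suc k then 1 else 0) + (\<Sum>j\<in>{2..n}. \<theta> j * (if j = Suc k then 1 else 0))\<bar> powr p = 1"
    if "k < n" for k
  proof (cases "k = 0")
    case True
    have "(\<Sum>j\<in>{2..n}. \<theta> j * (if j = Suc k then 1 else 0)) = 0"
      using True by (intro sum.neutral) auto
    then show ?thesis using True by simp
  next
    case False
    then have mem: "Suc k \<in> {2..n}" using that by auto
    moreover have "\<theta> (Suc k) = -1 \<or> \<theta> (Suc k) = 1" using PiE_mem[OF \<theta> mem] by simp
    moreover have "(\<Sum>j\<in>{2..n}. \<theta> j * (if j = Suc k then 1 else 0)) = (\<Sum>j\<in>{2..n}. if j = Suc k then \<theta> j else 0)"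
      by (intro sum.cong) auto
    ultimately show ?thesis using False by auto
  qed
  have "(\<Sum>k<n. \<bar>(if 1 = Suc k then 1 else 0) + (\<Sum>j\<in>{2..n}. \<theta> j * (if j = Suc k then 1 else 0))\<bar> powr p) = (\<Sum>k<n. 1)"
    by (intro sum.cong refl entry) simp
  then show "(\<Sum>k<n. \<bar>(if 1 = Suc k then 1 else 0) + (\<Sum>j\<in>{2..n}. \<theta> j * (if j = Suc k then 1 else 0))\<bar> powr p) = real n"
    by (simp only: sum_constant card_lessThan mult_1_right)
qed

text \<open>
  Index the \<open>2\<^sup>n\<^sup>-\<^sup>1\<close> sets by the sign patterns \<open>\<eta>\<close> on \<open>{2..n}\<close>, and let the \<open>j\<close>-th vector have the entries
  \<open>\<eta>\<^sub>j\<close> (with \<open>\<eta>\<^sub>1 = 1\<close>), scaled to norm \<open>1\<close>. All moduli are equal at every point, which is the equality case of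
  \<open>sign_sum_powr_le\<close>; and multiplication by \<open>\<theta>\<close> permutes the patterns, so every choice of
  signs gives the same norm, which is the equality case of Jensen's inequality.
\<close>

lemma extremal_family_of_sign_patterns:
  assumes p: "1 \<le> p" and n: "1 \<le> n" and E: "disjoint_positive_sets M (2 ^ (n - 1)) E"
  shows "\<exists>f. unit_family p M n f \<and>
    (\<forall>\<theta>\<in>{2..n} \<rightarrow>\<^sub>E {-1, 1}. (signed_norm p M n f \<theta>)\<^sup>2
      = (sign_sum (\<lambda>y. \<bar>1 + y\<bar> powr p) {2..n} (\<lambda>_. 1) / 2 ^ (n - 1)) powr (2 / p))"
proof -
  let ?T = "{2..n} \<rightarrow>\<^sub>E {-1, 1::real}"
  define m :: nat where "m = 2 ^ (n - 1)"
  have "finite ?T" "card ?T = m" using n by (auto intro!: finite_PiE simp: card_PiE m_def numeral_2_eq_2)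
  then obtain \<beta> where \<beta>: "bij_betw \<beta> {..<m} ?T"
    using ex_bij_betw_nat_finite[of ?T] by (auto simp: atLeast0LessThan)
  define w where "w = real m powr (- 1 / p)"
  have m: "0 < m" by (simp add: m_def)
  have "\<bar>w\<bar> powr p = real m powr (- 1)" using p by (simp add: w_def powr_powr)
  then have w: "\<bar>w\<bar> powr p = 1 / real m" using m by (simp add: powr_minus divide_inverse)
  define c where "c = (\<lambda>j k. w * (if j = 1 then 1 else \<beta> k j))"
  show ?thesis
  proof (rule step_fun_family[where c = c, OF p E])
    fix j assume j: "j \<in> {1..n}"
    have "\<bar>c j k\<bar> powr p = 1 / real m" if "k < m" for k
    proof -
      have "\<beta> k \<in> ?T" using \<beta> that by (auto dest: bij_betwE)
      from PiE_mem[OF this, of j] have "\<beta> k j = -1 \<or> \<beta> k j = 1" if "j \<noteq> 1"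
        using j that by simp
      then have "\<bar>if j = 1 then 1 else \<beta> k j\<bar> = 1" by auto
      then show ?thesis unfolding c_def abs_mult by (simp add: w)
    qed
    then show "(\<Sum>k<2 ^ (n - 1). \<bar>c j k\<bar> powr p) = 1"
      unfolding m_def[symmetric] using m by simp
  next
    fix \<theta> assume \<theta>: "\<theta> \<in> ?T"
    have c: "c 1 k + (\<Sum>j\<in>{2..n}. \<theta> j * c j k) = w * (1 + (\<Sum>j\<in>{2..n}. \<beta> k j * \<theta> j))" for k
    proof -
      have "(\<Sum>j\<in>{2..n}. \<theta> j * c j k) = (\<Sum>j\<in>{2..n}. w * (\<beta> k j * \<theta> j))"
        by (intro sum.cong) (auto simp: c_def)
      then show ?thesis by (simp add: c_def distrib_left sum_distrib_left)
    qed
    have "(\<Sum>k<2 ^ (n - 1). \<bar>c 1 k + (\<Sum>j\<in>{2..n}. \<theta> j * c j k)\<bar> powr p)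
        = (\<Sum>k<m. \<bar>1 + (\<Sum>j\<in>{2..n}. \<beta> k j * \<theta> j)\<bar> powr p) / real m"
      unfolding c abs_mult powr_mult w m_def[symmetric] by (simp add: sum_divide_distrib)
    also have "(\<Sum>k<m. \<bar>1 + (\<Sum>j\<in>{2..n}. \<beta> k j * \<theta> j)\<bar> powr p) = sign_sum (\<lambda>y. \<bar>1 + y\<bar> powr p) {2..n} \<theta>"
      unfolding sign_sum_def by (rule sum.reindex_bij_betw[OF \<beta>])
    \<comment> \<open>the roles of patterns and signs are exchanged: \<open>\<beta> k\<close> runs through all signs and \<open>\<theta>\<close> is a vector of moduli \<open>1\<close>\<close>
    also have "\<dots> = sign_sum (\<lambda>y. \<bar>1 + y\<bar> powr p) {2..n} (\<lambda>j. \<bar>\<theta> j\<bar>)"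
      by (simp add: sign_sum_abs)
    also have "\<dots> = sign_sum (\<lambda>y. \<bar>1 + y\<bar> powr p) {2..n} (\<lambda>_. 1)"
    proof (rule sign_sum_cong)
      show "\<bar>\<theta> j\<bar> = 1" if "j \<in> {2..n}" for j using PiE_mem[OF \<theta> that] by auto
    qed
    finally show "(\<Sum>k<2 ^ (n - 1). \<bar>c 1 k + (\<Sum>j\<in>{2..n}. \<theta> j * c j k)\<bar> powr p)
        = sign_sum (\<lambda>y. \<bar>1 + y\<bar> powr p) {2..n} (\<lambda>_. 1) / 2 ^ (n - 1)"
      by (simp add: m_def)
  qed
qed


section \<open>The constant of a space realising an Lp space\<close>

text \<open>
  \<open>X\<close> is \<open>L\<^sup>p(M)\<close> with \<open>\<pi>\<close> sending a function to the element it represents. That \<open>\<pi>\<close> annihilates null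
  functions is what turns a relation almost everywhere into a linear relation in \<open>X\<close>.
\<close>

locale Lp_realization = abelian_group X
  for X :: "('v, 'm) normed_module_scheme" (structure) +
  fixes p :: real and M :: "'a measure" and \<pi> :: "('a \<Rightarrow> real) \<Rightarrow> 'v"
  assumes p: "1 \<le> p"
    and carrier_eq: "carrier X = \<pi> ` Lp_fun p M"
    and \<pi>_add: "\<And>f g. f \<in> Lp_fun p M \<Longrightarrow> g \<in> Lp_fun p M \<Longrightarrow> \<pi> f \<oplus> \<pi> g = \<pi> (\<lambda>t. f t + g t)"
    and \<pi>_smult: "\<And>c f. f \<in> Lp_fun p M \<Longrightarrow> c \<odot>\<^bsub>X\<^esub> \<pi> f = \<pi> (\<lambda>t. c * f t)"
    and \<pi>_zero: "\<And>f. f \<in> Lp_fun p M \<Longrightarrow> (AE t in M. f t = 0) \<Longrightarrow> \<pi> f = \<zero>"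
    and \<pi>_norm: "\<And>f. f \<in> Lp_fun p M \<Longrightarrow> vnorm X (\<pi> f) = Lp_fun_norm p M f"
begin

lemma \<pi>_carrier: "f \<in> Lp_fun p M \<Longrightarrow> \<pi> f \<in> carrier X"
  by (simp add: carrier_eq)

lemma finsum_\<pi>:
  assumes "finite I" "\<And>j. j \<in> I \<Longrightarrow> f j \<in> Lp_fun p M"
  shows "(\<Oplus>j\<in>I. \<pi> (f j)) = \<pi> (\<lambda>t. \<Sum>j\<in>I. f j t)"
  using assms
proof (induction I)
  case empty
  then show ?case using \<pi>_zero[OF Lp_fun_zero] by simp
next
  case (insert i I)
  have "(\<Oplus>j\<in>insert i I. \<pi> (f j)) = \<pi> (f i) \<oplus> (\<Oplus>j\<in>I. \<pi> (f j))"
    using insert.hyps insert.prems by (intro finsum_insert) (auto intro!: \<pi>_carrier)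
  then show ?case
    using insert p by (simp add: \<pi>_add Lp_fun_sum)
qed

text \<open>
  Representatives of linearly independent elements are independent modulo null functions.
\<close>

lemma disjoint_positive_sets_of_space_dim:
  assumes m: "1 \<le> m" and dim: "enat m \<le> space_dim X"
  shows "\<exists>E. disjoint_positive_sets M m E"
proof -
  have "enat (m - 1) < (SUP B\<in>{B. lin_indep X B}. enat (card B))"
    using dim m unfolding space_dim_def by (metis One_nat_def diff_less enat_ord_simps(2) less_le_trans zero_less_one)
  then obtain B where B: "lin_indep X B" "m \<le> card B"
    by (auto simp: less_SUP_iff)
  have fin: "finite B" and carr: "B \<subseteq> carrier X"
    and ind: "\<And>a. (\<Oplus>v\<in>B. a v \<odot>\<^bsub>X\<^esub> v) = \<zero> \<Longrightarrow> \<forall>v\<in>B. a v = 0"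
    using B(1) by (auto simp: lin_indep_def)
  have "\<forall>v\<in>B. \<exists>f. f \<in> Lp_fun p M \<and> \<pi> f = v" using carr carrier_eq by auto
  then obtain f where f: "\<And>v. v \<in> B \<Longrightarrow> f v \<in> Lp_fun p M" "\<And>v. v \<in> B \<Longrightarrow> \<pi> (f v) = v"
    by metis
  obtain E where "disjoint_positive_sets M (card B) E"
  proof (rule exE[OF exists_disjoint_positive_sets[OF p fin f(1)]])
    fix a assume ae: "AE t in M. (\<Sum>v\<in>B. a v * f v t) = 0"
    have "(\<Oplus>v\<in>B. a v \<odot>\<^bsub>X\<^esub> v) = (\<Oplus>v\<in>B. \<pi> (\<lambda>t. a v * f v t))"
    proof (rule finsum_cong')
      show "(\<lambda>v. \<pi> (\<lambda>t. a v * f v t)) \<in> B \<rightarrow> carrier X"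
        using f(1) by (auto intro!: \<pi>_carrier Lp_fun_scale)
      show "a v \<odot>\<^bsub>X\<^esub> v = \<pi> (\<lambda>t. a v * f v t)" if "v \<in> B" for v
        using \<pi>_smult[OF f(1)[OF that]] f(2)[OF that] by simp
    qed simp
    also have "\<dots> = \<pi> (\<lambda>t. \<Sum>v\<in>B. a v * f v t)"
      using f(1) by (intro finsum_\<pi> fin Lp_fun_scale)
    also have "\<dots> = \<zero>"
      using p f(1) by (intro \<pi>_zero Lp_fun_sum fin Lp_fun_scale ae) auto
    finally show "\<forall>v\<in>B. a v = 0" by (rule ind)
  qed
  then show ?thesis using B(2)
    by (auto simp: disjoint_positive_sets_def intro: disjoint_family_on_mono[of "{..<m}" "{..<card B}"])
qed

lemma mNJ_quotient_\<pi>: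
  assumes n: "1 \<le> n" and f: "unit_family p M n f" and x: "\<And>j. j \<in> {1..n} \<Longrightarrow> x j = \<pi> (f j)"
  shows "mNJ_quotient n X x
       = (\<Sum>\<theta>\<in>{2..n} \<rightarrow>\<^sub>E {-1, 1}. (signed_norm p M n f \<theta>)\<^sup>2) / (2 ^ (n - 1) * real n)"
proof -
  have fL: "f j \<in> Lp_fun p M" "Lp_fun_norm p M (f j) = 1" if "j \<in> {1..n}" for j
    using f that by (auto simp: unit_family_def Lp_fun_norm_def)
  have "x 1 \<oplus> (\<Oplus>j\<in>{2..n}. \<theta> j \<odot>\<^bsub>X\<^esub> x j) = \<pi> (\<lambda>t. f 1 t + (\<Sum>j\<in>{2..n}. \<theta> j * f j t))" for \<theta>
  proof -
    have "(\<Oplus>j\<in>{2..n}. \<theta> j \<odot>\<^bsub>X\<^esub> x j) = (\<Oplus>j\<in>{2..n}. \<pi> (\<lambda>t. \<theta> j * f j t))"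
    proof (rule finsum_cong')
      show "(\<lambda>j. \<pi> (\<lambda>t. \<theta> j * f j t)) \<in> {2..n} \<rightarrow> carrier X"
        using fL(1) by (auto intro!: \<pi>_carrier Lp_fun_scale)
      show "\<theta> j \<odot>\<^bsub>X\<^esub> x j = \<pi> (\<lambda>t. \<theta> j * f j t)" if "j \<in> {2..n}" for j
        using that fL(1)[of j] x[of j] by (simp add: \<pi>_smult)
    qed simp
    also have "\<dots> = \<pi> (\<lambda>t. \<Sum>j\<in>{2..n}. \<theta> j * f j t)"
      using fL(1) by (intro finsum_\<pi> Lp_fun_scale) auto
    finally have rest: "(\<Oplus>j\<in>{2..n}. \<theta> j \<odot>\<^bsub>X\<^esub> x j) = \<pi> (\<lambda>t. \<Sum>j\<in>{2..n}. \<theta> j * f j t)" .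
    have x1: "x 1 = \<pi> (f 1)" using x n by simp
    show ?thesis
      unfolding rest x1 using fL(1) n p by (intro \<pi>_add Lp_fun_sum Lp_fun_scale) auto
  qed
  moreover have "(\<lambda>t. f 1 t + (\<Sum>j\<in>{2..n}. \<theta> j * f j t)) \<in> Lp_fun p M" for \<theta>
    using fL(1) n p by (intro Lp_fun_add Lp_fun_sum Lp_fun_scale) auto
  moreover have "vnorm X (x j) = 1" if "j \<in> {1..n}" for j
    using that fL x by (simp add: \<pi>_norm)
  ultimately show ?thesis
    by (simp add: mNJ_quotient_def signed_norm_def \<pi>_norm)
qed

text \<open>
  The supremum is a maximum: the bound \<open>upper\<close> on the sum of squared norms is met by the given family.
\<close>

lemma upper_mNJ_eq:
  assumes n: "1 \<le> n"
    and upper: "\<And>f. unit_family p M n f \<Longrightarrow>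
      (\<Sum>\<theta>\<in>{2..n} \<rightarrow>\<^sub>E {-1, 1}. (signed_norm p M n f \<theta>)\<^sup>2) \<le> 2 ^ (n - 1) * V"
    and attained: "\<exists>f. unit_family p M n f \<and> (\<forall>\<theta>\<in>{2..n} \<rightarrow>\<^sub>E {-1, 1}. (signed_norm p M n f \<theta>)\<^sup>2 = V)"
  shows "upper_mNJ n X = V / real n"
  unfolding upper_mNJ_def
proof (rule cSup_eq_maximum)
  obtain f where f: "unit_family p M n f"
    and V: "\<And>\<theta>. \<theta> \<in> {2..n} \<rightarrow>\<^sub>E {-1, 1} \<Longrightarrow> (signed_norm p M n f \<theta>)\<^sup>2 = V"
    using attained by blast
  have "real (card ({2..n} \<rightarrow>\<^sub>E {-1, 1::real})) = 2 ^ (n - 1)"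
    using n by (simp add: card_PiE numeral_2_eq_2)
  then have "mNJ_quotient n X (\<lambda>j. \<pi> (f j)) = V / real n"
    using mNJ_quotient_\<pi>[OF n f, of "\<lambda>j. \<pi> (f j)"] V by simp
  moreover have "(\<lambda>j. \<pi> (f j)) \<in> {1..n} \<rightarrow> unit_sphere X"
    using f by (auto simp: unit_sphere_def unit_family_def \<pi>_norm \<pi>_carrier Lp_fun_norm_def)
  ultimately show "V / real n \<in> mNJ_quotient n X ` ({1..n} \<rightarrow> unit_sphere X)"
    by (metis image_eqI)
next
  fix q assume "q \<in> mNJ_quotient n X ` ({1..n} \<rightarrow> unit_sphere X)"
  then obtain x where x: "x \<in> {1..n} \<rightarrow> unit_sphere X" and q: "q = mNJ_quotient n X x" by blast
  have "\<forall>j\<in>{1..n}. \<exists>g. g \<in> Lp_fun p M \<and> x j = \<pi> g"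
    using x carrier_eq by (fastforce simp: unit_sphere_def)
  then obtain f where f: "\<And>j. j \<in> {1..n} \<Longrightarrow> f j \<in> Lp_fun p M" "\<And>j. j \<in> {1..n} \<Longrightarrow> x j = \<pi> (f j)"
    by metis
  have unit: "unit_family p M n f"
    unfolding unit_family_def
  proof (intro ballI conjI f(1))
    fix j assume j: "j \<in> {1..n}"
    have "Lp_fun_norm p M (f j) = 1"
      using Pi_mem[OF x j] f(2)[OF j] \<pi>_norm[OF f(1)[OF j]] by (simp add: unit_sphere_def)
    then show "(\<integral>t. \<bar>f j t\<bar> powr p \<partial>M) = 1"
      using Lp_fun_norm_powr[of p M "f j"] p by simp
  qed
  have "q = (\<Sum>\<theta>\<in>{2..n} \<rightarrow>\<^sub>E {-1, 1}. (signed_norm p M n f \<theta>)\<^sup>2) / (2 ^ (n - 1) * real n)"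
    unfolding q by (rule mNJ_quotient_\<pi>[OF n unit]) (rule f(2))
  also have "\<dots> \<le> 2 ^ (n - 1) * V / (2 ^ (n - 1) * real n)"
    by (intro divide_right_mono upper[OF unit]) simp
  also have "\<dots> = V / real n" by simp
  finally show "q \<le> V / real n" .
qed

theorem upper_mNJ_of_p_le_2:
  assumes n: "1 \<le> n" and p2: "p \<le> 2" and dim: "enat n \<le> space_dim X"
  shows "upper_mNJ n X = real n powr (2 / p - 1)"
proof -
  have ins: "insert 1 {2..n} = {1..n}" using n by auto
  obtain E where E: "disjoint_positive_sets M n E"
    using disjoint_positive_sets_of_space_dim[OF n dim] by blast
  have "upper_mNJ n X = real n powr (2 / p) / real n"
  proof (rule upper_mNJ_eq[OF n])
    fix f assume "unit_family p M n f"
    then show "(\<Sum>\<theta>\<in>{2..n} \<rightarrow>\<^sub>E {-1, 1}. (signed_norm p M n f \<theta>)\<^sup>2) \<le> 2 ^ (n - 1) * real n powr (2 / p)"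
      using sum_signs_norm_power2_le_of_p_le_2[OF p p2, of "{2..n}" 1 f M]
      unfolding ins signed_norm_def by (simp add: unit_family_def)
  qed (rule extremal_family_of_n_sets[OF p n E])
  then show ?thesis using n by (simp add: powr_diff)
qed

theorem upper_mNJ_of_p_ge_2:
  assumes n: "1 \<le> n" and p2: "2 \<le> p" and dim: "enat (2 ^ (n - 1)) \<le> space_dim X"
  shows "upper_mNJ n X = 1 / real n * (2 powr (1 - real n) *
    (\<Sum>k=0..nat \<lfloor>real n / 2\<rfloor>. real (n choose k) * (real n - 2 * real k) powr p)) powr (2 / p)"
proof -
  let ?K = "sign_sum (\<lambda>y. \<bar>1 + y\<bar> powr p) {2..n} (\<lambda>_. 1)"
  have ins: "insert 1 {2..n} = {1..n}" using n by auto
  obtain E where E: "disjoint_positive_sets M (2 ^ (n - 1)) E"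
    using disjoint_positive_sets_of_space_dim[OF _ dim] by auto
  have "upper_mNJ n X = (?K / 2 ^ (n - 1)) powr (2 / p) / real n"
  proof (rule upper_mNJ_eq[OF n])
    fix f assume "unit_family p M n f"
    then show "(\<Sum>\<theta>\<in>{2..n} \<rightarrow>\<^sub>E {-1, 1}. (signed_norm p M n f \<theta>)\<^sup>2)
        \<le> 2 ^ (n - 1) * (?K / 2 ^ (n - 1)) powr (2 / p)"
      using sum_signs_norm_power2_le_of_p_ge_2[OF p2, of "{2..n}" 1 f M]
      unfolding ins signed_norm_def by (simp add: unit_family_def)
  qed (rule extremal_family_of_sign_patterns[OF p n E])
  moreover have "?K / 2 ^ (n - 1) = 2 powr (1 - real n) * ?K"
  proof -
    have "2 powr (1 - real n) = 2 powr (- real (n - 1))" using n by (simp add: of_nat_diff)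
    also have "\<dots> = 1 / 2 ^ (n - 1)" by (simp only: powr_minus powr_realpow zero_less_numeral divide_inverse mult_1_left)
    finally show ?thesis by simp
  qed
  ultimately show ?thesis by (simp add: sign_sum_one_plus_eq[OF n])
qed

end

lemma Lp_realization_Lp:
  assumes "1 \<le> p"
  shows "Lp_realization (Lp p M) p M (Lp_class p M)"
proof -
  interpret abelian_group "Lp p M" by (rule Lp_abelian_group) (use assms in simp)
  show ?thesis
  proof
    show "carrier (Lp p M) = Lp_class p M ` Lp_fun p M"
      by (auto elim: Lp_carrierE intro: Lp_class_carrier)
    show "Lp_class p M f = \<zero>\<^bsub>Lp p M\<^esub>" if "f \<in> Lp_fun p M" "AE t in M. f t = 0" for f
      using that Lp_class_eq[OF that(1) Lp_fun_zero] by (simp add: Lp_def)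
  qed (use assms in \<open>simp_all add: Lp_add Lp_smult Lp_vnorm\<close>)
qed

text \<open>
  The coordinates \<open>i < d\<close> with the counting measure; \<open>\<pi>\<close> cuts a function off outside them. The values of
  a function at other indices are invisible to this measure, whereas the sequences of \<open>l\<^sup>p\<close> vanish there.
\<close>

lemma Lp_realization_lp:
  assumes "1 \<le> p"
  shows "Lp_realization (lp p d) p (count_space {i. enat i < d}) (\<lambda>f i. if enat i < d then f i else 0)"
proof -
  let ?A = "{i. enat i < d}"
  let ?r = "\<lambda>f i. if enat i < d then f i else (0 :: real)"
  have restr: "\<bar>?r f i\<bar> powr p = indicator ?A i *\<^sub>R (\<bar>f i\<bar> powr p)" for f i
    using assms by simp
  have Lp_iff: "f \<in> Lp_fun p (count_space ?A) \<longleftrightarrow> summable (\<lambda>i. \<bar>?r f i\<bar> powr p)" for f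
  proof -
    have "integrable (count_space ?A) (\<lambda>i. \<bar>f i\<bar> powr p) \<longleftrightarrow> integrable (count_space UNIV) (\<lambda>i. \<bar>?r f i\<bar> powr p)"
      unfolding restr by (subst integrable_restrict_space[symmetric]) (auto simp: restrict_count_space)
    then show ?thesis by (simp add: Lp_fun_def integrable_count_space_nat_iff)
  qed
  have norm: "Lp_fun_norm p (count_space ?A) f = (\<Sum>i. \<bar>?r f i\<bar> powr p) powr (1 / p)"
    if "f \<in> Lp_fun p (count_space ?A)" for f
  proof -
    have "integrable (count_space UNIV) (\<lambda>i. \<bar>?r f i\<bar> powr p)"
      using that Lp_iff[of f] by (simp add: integrable_count_space_nat_iff)
    then have "(\<Sum>i. \<bar>?r f i\<bar> powr p) = (\<integral>i. \<bar>?r f i\<bar> powr p \<partial>count_space UNIV)"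
      by (rule integral_count_space_nat[symmetric])
    also have "\<dots> = (\<integral>i. \<bar>f i\<bar> powr p \<partial>count_space ?A)"
      unfolding restr by (subst integral_restrict_space[symmetric]) (auto simp: restrict_count_space)
    finally show ?thesis by (simp add: Lp_fun_norm_def)
  qed
  interpret abelian_group "lp p d" by (rule lp_abelian_group) (use assms in simp)
  show ?thesis
  proof
    show "carrier (lp p d) = ?r ` Lp_fun p (count_space ?A)"
    proof (intro equalityI subsetI)
      fix x assume x: "x \<in> carrier (lp p d)"
      then have r: "?r x i = x i" for i by (auto simp: lp_def not_less)
      have x_Lp: "x \<in> Lp_fun p (count_space ?A)"
        unfolding Lp_iff r using x by (simp add: lp_def)
      have "x = ?r x" by (rule ext) (simp only: r)
      from image_eqI[where f = ?r, OF this x_Lp] show "x \<in> ?r ` Lp_fun p (count_space ?A)" .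
    next
      fix x assume "x \<in> ?r ` Lp_fun p (count_space ?A)"
      then show "x \<in> carrier (lp p d)" by (auto simp: Lp_iff lp_def not_less)
    qed
    show "?r f = \<zero>\<^bsub>lp p d\<^esub>" if "AE t in count_space ?A. f t = 0" for f
      using that by (auto simp: AE_count_space lp_def)
    show "vnorm (lp p d) (?r f) = Lp_fun_norm p (count_space ?A) f"
      if "f \<in> Lp_fun p (count_space ?A)" for f
      using norm[OF that] by (simp add: lp_def)
  qed (use assms in \<open>auto simp: lp_def\<close>)
qed

theorem theorem12:
  fixes n :: nat and p :: real and M :: "'a measure" and d :: enat
  assumes "n \<ge> 2" and "1 \<le> p"
  shows
    "(p \<le> 2 \<longrightarrow>
        (space_dim (Lp p M) \<ge> enat n \<longrightarrow> upper_mNJ n (Lp p M) = real n powr (2 / p - 1)) \<and>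
        (space_dim (lp p d) \<ge> enat n \<longrightarrow> upper_mNJ n (lp p d) = real n powr (2 / p - 1))) \<and>
     (2 < p \<longrightarrow>
        (space_dim (Lp p M) \<ge> enat (2 ^ (n - 1)) \<longrightarrow>
           upper_mNJ n (Lp p M) =
             1 / real n * (2 powr (1 - real n) *
               (\<Sum>k=0..nat \<lfloor>real n / 2\<rfloor>. real (n choose k) * (real n - 2 * real k) powr p)) powr (2 / p)) \<and>
        (space_dim (lp p d) \<ge> enat (2 ^ (n - 1)) \<longrightarrow>
           upper_mNJ n (lp p d) =
             1 / real n * (2 powr (1 - real n) *
               (\<Sum>k=0..nat \<lfloor>real n / 2\<rfloor>. real (n choose k) * (real n - 2 * real k) powr p)) powr (2 / p)))"
proof -
  interpret L: Lp_realization "Lp p M" p M "Lp_class p M"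
    by (rule Lp_realization_Lp) fact
  interpret l: Lp_realization "lp p d" p "count_space {i. enat i < d}" "\<lambda>f i. if enat i < d then f i else 0"
    by (rule Lp_realization_lp) fact
  show ?thesis
    using assms(1) L.upper_mNJ_of_p_le_2[of n] l.upper_mNJ_of_p_le_2[of n]
      L.upper_mNJ_of_p_ge_2[of n] l.upper_mNJ_of_p_ge_2[of n]
    by auto
qed

end
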